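(* Let $n=127$, $N=2^{n}$, $\mathcal H=(\mathbb C^2)^{\otimes n}$, let $M>0$, let $H_0$ be an $N\times N$ self-adjoint matrix with zero trace, and let $\mathcal E$ be a directed graph with vertex set $\{1,\dots,n\}$, viewed as a set of ordered pairs $(c,t)$ with $c\neq t$. Consider the controlled Schrödinger equation $$ i\frac{d}{dt}\psi(t)=\Big(H_0+\sum_{k=1}^{n}\big(u_k^X(t)X_k+u_k^Y(t)Y_k\big)+\sum_{(c,t')\in\mathcal E}v_{ct'}(t)\,Z_cX_{t'}\Big)\psi(t), $$ with real-valued controls $u_k^X,u_k^Y$ ($1\le k\le n$) and $v_{ct'}$ ($(c,t')\in\mathcal E$). Assume that the graph $\mathcal E$ is connected. Then this equation is operator controllable: for every special unitary operator $\Gamma\in SU(N)$ there exist a time horizon $T>0$ and measurable controls $u_k^X,u_k^Y,v_{ct'}:[0,T]\to[-M,M]$ such that the solution $U$ of the matrix Cauchy problem $$ i\frac{d}{dt}U(t)=\Big(H_0+\sum_{k=1}^{n}\big(u_k^X(t)X_k+u_k^Y(t)Y_k\big)+\sum_{(c,t')\in\mathcal E}v_{ct'}(t)\,Z_cX_{t'}\Big)U(t),\quad t\in(0,T),\qquad U(0)=I, $$ satisfies $U(T)=\Gamma$.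
   Context: $X=\begin{pmatrix}0&1\\1&0\end{pmatrix}$, $Y=\begin{pmatrix}0&-i\\i&0\end{pmatrix}$, $Z=\begin{pmatrix}1&0\\0&-1\end{pmatrix}$ are the Pauli matrices. For a $2\times2$ matrix $A$, $A_k$ denotes the operator on $(\mathbb C^2)^{\otimes n}$ acting as $A$ on the $k$-th tensor factor and as the identity on all others; $Z_cX_{t'}$ is the product of $Z_c$ and $X_{t'}$ (i.e. $Z$ acts on factor $c$, $X$ acts on factor $t'$, identity elsewhere). A directed graph is called connected if its underlying undirected graph is connected. *)

theory Defs
  imports "Graph_Theory.Digraph_Component" "HOL-Analysis.Analysis"
begin

section \<open>Complex matrices\<close>

definition conj_transpose :: "complex^'n^'m \<Rightarrow> complex^'m^'n" where
  "conj_transpose A = (\<chi> i j. cnj (A $ j $ i))"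

definition self_adjoint :: "complex^'n^'n \<Rightarrow> bool" where
  "self_adjoint A \<longleftrightarrow> conj_transpose A = A"

definition unitary :: "complex^'n^'n \<Rightarrow> bool" where
  "unitary A \<longleftrightarrow> conj_transpose A ** A = mat 1 \<and> A ** conj_transpose A = mat 1"

definition special_unitary :: "complex^'n^'n \<Rightarrow> bool" where
  "special_unitary A \<longleftrightarrow> unitary A \<and> det A = 1"

section \<open>Operators on qubits\<close>

text \<open>
  The qubits are labelled by a finite type \<open>'n\<close>. The function type \<open>'n \<Rightarrow> 2\<close> indexes the product
  basis of the \<open>'n\<close>-fold tensor power of \<open>complex^2\<close>: the index \<open>s\<close> stands for the tensor product of
  the standard basis vectors \<open>e\<^bsub>s k\<^esub>\<close>, so operators are square matrices of size \<open>2 ^ CARD('n)\<close>.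
  The type \<open>2\<close> has the two elements \<open>1\<close> and \<open>2 = 0\<close>, and \<open>vector\<close> lists the entry at \<open>1\<close> first.
\<close>

type_synonym 'n qubit_operator = "complex^('n \<Rightarrow> 2)^('n \<Rightarrow> 2)"

lemma card_qubit_basis: "CARD('n::finite \<Rightarrow> 2) = 2 ^ CARD('n)"
  by (simp add: card_fun)

definition pauli_X :: "complex^2^2" where
  "pauli_X = vector [vector [0, 1], vector [1, 0]]"

definition pauli_Y :: "complex^2^2" where
  "pauli_Y = vector [vector [0, - \<i>], vector [\<i>, 0]]"

definition pauli_Z :: "complex^2^2" where
  "pauli_Z = vector [vector [1, 0], vector [0, - 1]]"

text \<open>The matrix of a tensor product in the product basis (iterated Kronecker product).\<close>

definition tensor_op :: "('n::finite \<Rightarrow> complex^2^2) \<Rightarrow> 'n qubit_operator" where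
  "tensor_op A = (\<chi> r s. \<Prod>j\<in>UNIV. A j $ r j $ s j)"

definition acting_on :: "complex^2^2 \<Rightarrow> 'n::finite \<Rightarrow> 'n qubit_operator" where
  "acting_on A k = tensor_op (\<lambda>j. if j = k then A else mat 1)"

section \<open>The controlled equation\<close>

definition hamiltonian ::
  "'n::finite qubit_operator \<Rightarrow> ('n \<times> 'n) set \<Rightarrow> ('n \<Rightarrow> real \<Rightarrow> real) \<Rightarrow> ('n \<Rightarrow> real \<Rightarrow> real) \<Rightarrow>
    ('n \<Rightarrow> 'n \<Rightarrow> real \<Rightarrow> real) \<Rightarrow> real \<Rightarrow> 'n qubit_operator" where
  "hamiltonian H0 E uX uY v t =
     H0 + (\<Sum>k\<in>UNIV. uX k t *\<^sub>R acting_on pauli_X k + uY k t *\<^sub>R acting_on pauli_Y k)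
        + (\<Sum>(c, t')\<in>E. v c t' t *\<^sub>R (acting_on pauli_Z c ** acting_on pauli_X t'))"

definition admissible_control :: "real \<Rightarrow> real \<Rightarrow> (real \<Rightarrow> real) \<Rightarrow> bool" where
  "admissible_control M T u \<longleftrightarrow>
     u \<in> borel_measurable (lebesgue_on {0..T}) \<and> u ` {0..T} \<subseteq> {- M..M}"

definition abs_continuous_on :: "real set \<Rightarrow> (real \<Rightarrow> 'a::real_normed_vector) \<Rightarrow> bool" where
  "abs_continuous_on S f \<longleftrightarrow>
     (\<forall>\<epsilon>>0. \<exists>\<delta>>0. \<forall>d. d division_of \<Union>d \<and> \<Union>d \<subseteq> S \<and> (\<Sum>K\<in>d. Sup K - Inf K) < \<delta> \<longrightarrow>
        (\<Sum>K\<in>d. norm (f (Sup K) - f (Inf K))) < \<epsilon>)"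

text \<open>
  Since controls are merely measurable, solutions are meant in the sense of Caratheodory: absolutely
  continuous on the closed interval and satisfying the equation almost everywhere.
  The matrix product with \<open>mat \<i>\<close> is multiplication by the scalar \<open>\<i>\<close>.
\<close>

definition schroedinger_solution ::
  "(real \<Rightarrow> complex^'m^'m) \<Rightarrow> real \<Rightarrow> (real \<Rightarrow> complex^'m^'m) \<Rightarrow> bool" where
  "schroedinger_solution H T U \<longleftrightarrow>
     abs_continuous_on {0..T} U \<and>
     U 0 = mat 1 \<and>
     (AE t in lebesgue. t \<in> {0<..<T} \<longrightarrow>
        (\<exists>D. (U has_vector_derivative D) (at t) \<and> mat \<i> ** D = H t ** U t))"

end

theory Submission
  imports Defs
begin

text \<open>
  The end points of piecewise constant controls form a semigroup \<open>S\<close> in the special unitary group,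
  generated by the exponentials \<open>exp (t A)\<close>, \<open>t > 0\<close>, of directions \<open>A = - \<i> H\<close>,
  one for each admissible constant choice of the controls.
  Its closure \<open>C\<close> is a compact group, and the span of the \<open>C\<close>-conjugates of the directions is a Lie
  algebra. Differences of directions are multiples of the control operators, whose commutators yield,
  along paths of the graph, all nontrivial Pauli strings; so this span is the whole Lie algebra \<open>su\<close>.

  Since finitely many conjugates of directions span \<open>su\<close>, a suitable product of elements of \<open>S\<close> with
  free switching times is a submersion, hence \<open>S\<close> contains a nonempty open subset of the special
  unitary group. A variational diagonalisation shows that \<open>C\<close> is the whole special unitary group; a
  dense semigroup with nonempty interior is everything.
\<close>

section \<open>Matrices\<close>

text \<open>The drift \<open>H0\<close> can be neither switched off nor run backwards, so only
  positive times occur and inverses are not at hand inside \<open>S\<close>; they appear only in the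
  closure. There, conjugates of directions are the working objects rather than brackets: a conjugate
  is the velocity of a curve in \<open>C\<close> and a limit of conjugates by elements of
  \<open>S\<close>, whereas a bracket is a second-order effect. Openness is obtained without
  manifold charts: the special unitary matrices are thickened to a neighbourhood in the full matrix
  space, where an open mapping theorem applies. In the same spirit neither connectedness of the
  special unitary group nor surjectivity of its exponential is invoked: a maximum of a trace
  functional on the compact set \<open>C \<times> C\<close> reduces the question to diagonal
  matrices, whose roots near the identity are explicit. The bound \<open>M\<close> may be small
  because time is free: comparing zero controls with a single control at the value \<open>M\<close>
  already separates the control operators from the drift.\<close>

lemma bounded_bilinear_matrix_mult:
  "bounded_bilinear ((**) :: complex^'n^'m \<Rightarrow> complex^'p^'n \<Rightarrow> complex^'p^'m)"
proof -
  have "bilinear ((**) :: complex^'n^'m \<Rightarrow> complex^'p^'n \<Rightarrow> complex^'p^'m)"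
    unfolding bilinear_def linear_iff
    by (simp add: matrix_matrix_mult_def vec_eq_iff sum.distrib algebra_simps scaleR_sum_right)
  then show ?thesis
    using bilinear_conv_bounded_bilinear by blast
qed

interpretation mm: bounded_bilinear "(**) :: complex^'n^'m \<Rightarrow> complex^'p^'n \<Rightarrow> complex^'p^'m"
  by (rule bounded_bilinear_matrix_mult)

lemma mat_mult_nth: "(A ** B) $ i $ j = (\<Sum>k\<in>UNIV. A $ i $ k * B $ k $ j)"
  by (simp add: matrix_matrix_mult_def)

lemma conj_transpose_nth [simp]: "conj_transpose A $ i $ j = cnj (A $ j $ i)"
  by (simp add: conj_transpose_def)

lemma mat_nth: "mat c $ i $ j = (if i = j then c else 0)"
  by (simp add: mat_def)

lemma mat_mult_left_nth [simp]: "(mat c ** A) $ i $ j = c * A $ i $ j"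
  for A :: "complex^'n^'m"
proof -
  have "(mat c ** A) $ i $ j = (\<Sum>k\<in>UNIV. if k = i then c * A $ k $ j else 0)"
    unfolding mat_mult_nth by (rule sum.cong) (auto simp: mat_nth)
  then show ?thesis by simp
qed

lemma mat_mult_right_nth [simp]: "(A ** mat c) $ i $ j = c * A $ i $ j"
  for A :: "complex^'n^'m"
proof -
  have "(A ** mat c) $ i $ j = (\<Sum>k\<in>UNIV. if k = j then c * A $ i $ k else 0)"
    unfolding mat_mult_nth by (rule sum.cong) (auto simp: mat_nth)
  then show ?thesis by simp
qed

lemma mat_mult_commute: "A ** mat c = mat c ** (A :: complex^'n^'n)"
  by (simp add: vec_eq_iff)

lemma mat_mat: "mat a ** mat b = (mat (a * b) :: complex^'n^'n)"
  by (simp add: vec_eq_iff) (simp add: mat_nth)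

lemma mat_mult_mat_mult: "(mat a ** A) ** (mat b ** B) = mat (a * b) ** (A ** B)"
  for A B :: "complex^'n^'n"
proof -
  have "(mat a ** A) ** (mat b ** B) = mat a ** (A ** mat b) ** B"
    by (simp only: matrix_mul_assoc)
  also have "\<dots> = (mat a ** mat b) ** (A ** B)"
    by (simp only: mat_mult_commute[of A] matrix_mul_assoc)
  finally show ?thesis by (simp only: mat_mat)
qed

lemma scaleR_eq_mat: "x *\<^sub>R A = mat (of_real x) ** A" for A :: "complex^'n^'m"
  by (simp add: vec_eq_iff) (simp add: scaleR_conv_of_real)

lemma linear_conj_transpose: "linear (conj_transpose :: complex^'n^'m \<Rightarrow> complex^'m^'n)"
  by (simp add: linear_iff vec_eq_iff)

lemma bounded_linear_conj_transpose:
  "bounded_linear (conj_transpose :: complex^'n^'m \<Rightarrow> complex^'m^'n)"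
  using linear_conj_transpose by (rule linear_conv_bounded_linear[THEN iffD1])

lemmas conj_transpose_linear =
  linear_0[OF linear_conj_transpose] linear_add[OF linear_conj_transpose]
  linear_diff[OF linear_conj_transpose] linear_neg[OF linear_conj_transpose]
  linear_scale[OF linear_conj_transpose]

lemma conj_transpose_mult: "conj_transpose (A ** B) = conj_transpose B ** conj_transpose A"
  by (simp add: vec_eq_iff mat_mult_nth mult.commute)

lemma conj_transpose_mat [simp]: "conj_transpose (mat c) = mat (cnj c)"
  by (simp add: vec_eq_iff mat_nth)

lemma conj_transpose_conj_transpose [simp]: "conj_transpose (conj_transpose A) = A"
  by (simp add: vec_eq_iff)

lemma trace_mat: "trace (mat c :: complex^'n^'n) = of_nat CARD('n) * c"
  by (simp add: trace_def mat_nth)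

lemma trace_mat_mult: "trace (mat c ** A) = c * trace A" for A :: "complex^'n^'n"
  by (simp add: trace_def sum_distrib_left)

lemma trace_conj_transpose: "trace (conj_transpose A) = cnj (trace A)"
  by (simp add: trace_def)

lemma linear_trace: "linear (trace :: complex^'n^'n \<Rightarrow> complex)"
  by (simp add: linear_iff trace_def sum.distrib scaleR_sum_right)

lemma trace_mult_commute: "trace (A ** B) = trace (B ** A)" for A B :: "complex^'n^'n"
  by (rule trace_mul_sym)

lemma trace_scaleR: "trace (x *\<^sub>R A) = x *\<^sub>R trace A" for A :: "complex^'n^'n"
  by (simp add: trace_def scaleR_sum_right)

lemma norm_entry_le: "norm (A $ i $ j) \<le> norm (A :: complex^'n^'m)"
  by (meson Finite_Cartesian_Product.norm_nth_le order_trans)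

lemma norm_le_sum_entries: "norm A \<le> (\<Sum>i\<in>UNIV. \<Sum>j\<in>UNIV. norm (A $ i $ j))"
  for A :: "complex^'n^'m"
proof -
  have "norm A \<le> (\<Sum>i\<in>UNIV. norm (A $ i))"
    unfolding norm_vec_def[of A] by (rule L2_set_le_sum) simp
  also have "\<dots> \<le> (\<Sum>i\<in>UNIV. \<Sum>j\<in>UNIV. norm (A $ i $ j))"
    unfolding norm_vec_def[of "A $ _"] by (intro sum_mono L2_set_le_sum) simp
  finally show ?thesis .
qed

section \<open>The special unitary group and its Lie algebra\<close>

definition su :: "(complex^'n^'n) set" where
  "su = {A. conj_transpose A = - A \<and> trace A = 0}"

lemma subspace_su: "subspace su"
  by (auto simp: subspace_def su_def conj_transpose_linear trace_add trace_scaleR linear_0[OF linear_trace])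

lemma unitary_mult: "unitary A \<Longrightarrow> unitary B \<Longrightarrow> unitary (A ** B)"
  unfolding unitary_def conj_transpose_mult
  by (metis matrix_mul_assoc matrix_mul_lid)

lemma unitary_conj_transpose: "unitary A \<Longrightarrow> unitary (conj_transpose A)"
  by (simp add: unitary_def)

lemma unitary_cancel_left: "unitary A \<Longrightarrow> conj_transpose A ** (A ** B) = B"
  by (simp add: unitary_def matrix_mul_assoc)

lemma unitary_cancel_left': "unitary A \<Longrightarrow> A ** (conj_transpose A ** B) = B"
  by (simp add: unitary_def matrix_mul_assoc)

lemma special_unitary_mult:
  "special_unitary A \<Longrightarrow> special_unitary B \<Longrightarrow> special_unitary (A ** B)"
  by (simp add: special_unitary_def unitary_mult det_mul)

lemma special_unitary_conj_transpose:
  assumes "special_unitary A" shows "special_unitary (conj_transpose A)"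
proof -
  have "det (conj_transpose A) * det A = 1"
    using assms det_mul[of "conj_transpose A" A]
    by (simp add: special_unitary_def unitary_def det_I)
  then have "det (conj_transpose A) = 1"
    using assms by (simp add: special_unitary_def)
  then show ?thesis
    using assms by (simp add: special_unitary_def unitary_conj_transpose)
qed

lemma compact_unitary: "compact {A :: complex^'n^'n. unitary A}"
proof -
  have "norm (A $ i $ j) \<le> 1" if "unitary A" for A :: "complex^'n^'n" and i j
  proof -
    have "(\<Sum>k\<in>UNIV. (norm (A $ i $ k))\<^sup>2) = Re ((A ** conj_transpose A) $ i $ i)"
      by (simp add: mat_mult_nth complex_norm_square[symmetric] flip: of_real_power)
    also have "\<dots> = 1" using that by (simp add: unitary_def mat_nth)
    finally have "(norm (A $ i $ j))\<^sup>2 \<le> 1"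
      using member_le_sum[of j UNIV "\<lambda>k. (norm (A $ i $ k))\<^sup>2"] by simp
    then show ?thesis by (simp add: power_le_one_iff)
  qed
  then have "norm A \<le> (\<Sum>i\<in>(UNIV::'n set). \<Sum>j\<in>(UNIV::'n set). 1)" if "unitary A" for A :: "complex^'n^'n"
    using that by (intro order_trans[OF norm_le_sum_entries] sum_mono) auto
  then have "bounded {A :: complex^'n^'n. unitary A}"
    unfolding bounded_iff by blast
  moreover have "closed {A :: complex^'n^'n. unitary A}"
    unfolding unitary_def
    by (intro closed_Collect_conj closed_Collect_eq mm.continuous_on bounded_linear.continuous_on[OF bounded_linear_conj_transpose]
        continuous_on_id continuous_on_const)
  ultimately show ?thesis
    by (simp add: compact_eq_bounded_closed)
qed

section \<open>The matrix exponential\<close>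

lemma has_vector_derivative_vecI:
  fixes f :: "real \<Rightarrow> 'a::real_normed_vector^'n"
  assumes "\<And>i. ((\<lambda>t. f t $ i) has_vector_derivative D $ i) (at t)"
  shows "(f has_vector_derivative D) (at t)"
proof -
  have "((\<lambda>y. ((f y - f t) - (y - t) *\<^sub>R D) /\<^sub>R norm (y - t)) \<longlongrightarrow> 0) (at t)"
    using assms
    by (intro vec_tendstoI) (simp add: has_vector_derivative_def has_derivative_at_within)
  then show ?thesis
    by (simp add: has_vector_derivative_def has_derivative_at_within bounded_linear_scaleR_left)
qed

text \<open>The type-class product on \<open>complex^'n^'n\<close> is entrywise, so powers with
  respect to \<open>**\<close> have a recursion of their own.\<close>

primrec mpow :: "complex^'n^'n \<Rightarrow> nat \<Rightarrow> complex^'n^'n" where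
  "mpow A 0 = mat 1"
| "mpow A (Suc n) = A ** mpow A n"

lemma mpow_add: "mpow A (m + n) = mpow A m ** mpow A n"
  by (induction m) (simp_all add: matrix_mul_assoc)

lemma mpow_Suc_right: "mpow A (Suc n) = mpow A n ** A"
  using mpow_add[of A n 1] by simp

definition mcoeff :: "complex^'n^'n \<Rightarrow> nat \<Rightarrow> 'n \<Rightarrow> 'n \<Rightarrow> complex" where
  "mcoeff A n i j = mpow A n $ i $ j / fact n"

text \<open>Each entry is a scalar power series in t, so convergence and termwise differentiation
  come from the theory of power series in one complex variable.\<close>

definition mexp :: "complex^'n^'n \<Rightarrow> real \<Rightarrow> complex^'n^'n" where
  "mexp A t = (\<chi> i j. \<Sum>n. mcoeff A n i j * of_real t ^ n)"

lemma mcoeff_Suc: "of_nat (Suc n) * mcoeff A (Suc n) i j = (\<Sum>k\<in>UNIV. A $ i $ k * mcoeff A n k j)"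
proof -
  have "of_nat (Suc n) * mcoeff A (Suc n) i j = (A ** mpow A n) $ i $ j / fact n"
    by (simp add: mcoeff_def del: of_nat_Suc)
  then show ?thesis
    by (simp add: mat_mult_nth mcoeff_def sum_divide_distrib)
qed

lemma mcoeff_Suc': "of_nat (Suc n) * mcoeff A (Suc n) i j = (\<Sum>k\<in>UNIV. mcoeff A n i k * A $ k $ j)"
proof -
  have "of_nat (Suc n) * mcoeff A (Suc n) i j = (mpow A n ** A) $ i $ j / fact n"
    by (simp add: mcoeff_def mpow_Suc_right del: of_nat_Suc mpow.simps)
  then show ?thesis
    by (simp add: mat_mult_nth mcoeff_def sum_divide_distrib)
qed

text \<open>The sum of the absolute values of all entries dominates every row sum, so each further
  factor \<open>A\<close> costs at most this constant. Its exponential series is the majorant used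
  for convergence.\<close>

lemma norm_mpow_le:
  fixes A :: "complex^'n^'n"
  shows "norm (mpow A n $ i $ j) \<le> (\<Sum>i\<in>UNIV. \<Sum>j\<in>UNIV. norm (A $ i $ j)) ^ n"
proof (induction n arbitrary: i)
  case 0
  then show ?case by (simp add: mat_nth)
next
  case (Suc n)
  let ?K = "\<Sum>i\<in>UNIV. \<Sum>j\<in>UNIV. norm (A $ i $ j)"
  have K: "(\<Sum>k\<in>UNIV. norm (A $ i $ k)) \<le> ?K"
    using member_le_sum[of i UNIV "\<lambda>i. \<Sum>k\<in>UNIV. norm (A $ i $ k)"] by (simp add: sum_nonneg)
  have "norm (mpow A (Suc n) $ i $ j) \<le> (\<Sum>k\<in>UNIV. norm (A $ i $ k) * norm (mpow A n $ k $ j))"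
    by (simp add: mat_mult_nth norm_mult[symmetric] norm_sum)
  also have "\<dots> \<le> (\<Sum>k\<in>UNIV. norm (A $ i $ k) * ?K ^ n)"
    by (intro sum_mono mult_left_mono Suc.IH) simp
  also have "\<dots> \<le> ?K * ?K ^ n"
    unfolding sum_distrib_right[symmetric] using K
    by (intro mult_right_mono) (auto intro!: zero_le_power sum_nonneg)
  finally show ?case by simp
qed

lemma summable_mcoeff: "summable (\<lambda>n. mcoeff A n i j * z ^ n)"
proof (rule summable_comparison_test')
  let ?K = "\<Sum>i\<in>UNIV. \<Sum>j\<in>UNIV. norm (A $ i $ j)"
  show "summable (\<lambda>n. (?K * norm z) ^ n / fact n)"
    using summable_exp[of "?K * norm z"] by (simp add: field_simps)
  show "norm (mcoeff A n i j * z ^ n) \<le> (?K * norm z) ^ n / fact n" if "n \<ge> 0" for n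
    using norm_mpow_le[of A n i j]
    by (simp add: mcoeff_def norm_mult norm_divide norm_power power_mult_distrib divide_simps mult_right_mono)
qed

lemma mexp_0 [simp]: "mexp A 0 = mat 1"
proof -
  have "(\<Sum>n. mcoeff A n i j * of_real 0 ^ n) = mat 1 $ i $ j" for i j
    using powser_zero[of "\<lambda>n. mcoeff A n i j"] by (simp add: mcoeff_def)
  then show ?thesis by (simp add: mexp_def vec_eq_iff)
qed

lemma mult_mexp_nth:
  "(A ** mexp A t) $ i $ j = (\<Sum>n. of_nat (Suc n) * mcoeff A (Suc n) i j * of_real t ^ n)"
proof -
  have "(A ** mexp A t) $ i $ j = (\<Sum>k\<in>UNIV. \<Sum>n. A $ i $ k * (mcoeff A n k j * of_real t ^ n))"
    by (simp add: mat_mult_nth mexp_def suminf_mult[OF summable_mcoeff])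
  also have "\<dots> = (\<Sum>n. \<Sum>k\<in>UNIV. A $ i $ k * (mcoeff A n k j * of_real t ^ n))"
    by (intro suminf_sum[symmetric] summable_mult summable_mcoeff)
  finally show ?thesis
    by (simp add: mcoeff_Suc sum_distrib_right mult.assoc del: of_nat_Suc)
qed

lemma mexp_commute: "mexp A t ** A = A ** mexp A t"
proof -
  have "(mexp A t ** A) $ i $ j = (A ** mexp A t) $ i $ j" for i j
  proof -
    have "(mexp A t ** A) $ i $ j = (\<Sum>k\<in>UNIV. \<Sum>n. mcoeff A n i k * of_real t ^ n * A $ k $ j)"
      by (simp add: mat_mult_nth mexp_def suminf_mult2[OF summable_mcoeff])
    also have "\<dots> = (\<Sum>n. \<Sum>k\<in>UNIV. mcoeff A n i k * of_real t ^ n * A $ k $ j)"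
      by (intro suminf_sum[symmetric] summable_mult2 summable_mcoeff)
    finally show ?thesis
      by (simp add: mult_mexp_nth mcoeff_Suc' sum_distrib_right sum_distrib_left mult_ac del: of_nat_Suc)
  qed
  then show ?thesis by (simp add: vec_eq_iff)
qed

lemma mexp_has_vector_derivative: "(mexp A has_vector_derivative A ** mexp A t) (at t)"
proof (intro has_vector_derivative_vecI)
  fix i j
  let ?c = "\<lambda>n. mcoeff A n i j"
  have "((\<lambda>x. \<Sum>n. ?c n * x^n) has_field_derivative (\<Sum>n. diffs ?c n * of_real t ^ n))
      (at (of_real t))"
    by (rule termdiffs_strong_converges_everywhere) (rule summable_mcoeff)
  also have "(\<Sum>n. diffs ?c n * of_real t ^ n) = (A ** mexp A t) $ i $ j"
    by (simp add: mult_mexp_nth diffs_def)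
  finally have "((\<lambda>t. \<Sum>n. ?c n * of_real t ^ n) has_vector_derivative (A ** mexp A t) $ i $ j) (at t)"
    by (rule has_vector_derivative_real_field)
  moreover have "(\<lambda>t. mexp A t $ i $ j) = (\<lambda>t. \<Sum>n. ?c n * of_real t ^ n)"
    by (simp add: mexp_def)
  ultimately show "((\<lambda>t. mexp A t $ i $ j) has_vector_derivative (A ** mexp A t) $ i $ j) (at t)"
    by simp
qed

lemma mexp_has_vector_derivative_affine:
  "((\<lambda>t. mexp A (a * t + b)) has_vector_derivative a *\<^sub>R (A ** mexp A (a * t + b))) (at t)"
proof -
  have "((\<lambda>t. a * t + b) has_vector_derivative a) (at t)"
    by (auto intro!: derivative_eq_intros)
  from vector_diff_chain_at[OF this mexp_has_vector_derivative] show ?thesis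
    by (simp add: o_def)
qed

lemma has_vector_derivative_zero_imp_eq:
  fixes f :: "real \<Rightarrow> 'a::real_normed_vector"
  assumes "\<And>t. (f has_vector_derivative 0) (at t)"
  shows "f s = f t"
proof -
  obtain c where "\<And>x. x \<in> UNIV \<Longrightarrow> f x = c"
    using has_vector_derivative_zero_constant[of UNIV f] assms by auto
  then show ?thesis by simp
qed

text \<open>The product has zero derivative because \<open>A\<close> commutes with its exponential,
  and it is the identity at time 0. The same device yields the functional equation, unitarity and
  the determinant below.\<close>

lemma mexp_minus: "mexp A (- t) ** mexp A t = mat 1"
proof -
  have d: "((\<lambda>t. mexp A (- t)) has_vector_derivative - (A ** mexp A (- t))) (at t)" for t
    using mexp_has_vector_derivative_affine[of A "-1" 0] by simp
  have "((\<lambda>t. mexp A (- t) ** mexp A t) has_vector_derivative 0) (at t)" for t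
    using mm.has_vector_derivative[OF d mexp_has_vector_derivative[of A]]
    by (simp add: mm.minus_left matrix_mul_assoc mexp_commute)
  from has_vector_derivative_zero_imp_eq[OF this, of t 0] show ?thesis by simp
qed

lemma mexp_add: "mexp A (s + t) = mexp A s ** mexp A t"
proof -
  have d: "((\<lambda>t. mexp A (- t)) has_vector_derivative - (A ** mexp A (- t))) (at t)" for t
    using mexp_has_vector_derivative_affine[of A "-1" 0] by simp
  have d': "((\<lambda>s. mexp A (s + t)) has_vector_derivative A ** mexp A (s + t)) (at s)" for s
    using mexp_has_vector_derivative_affine[of A 1 t] by simp
  have "((\<lambda>s. mexp A (- s) ** mexp A (s + t)) has_vector_derivative 0) (at s)" for s
    using mm.has_vector_derivative[OF d d']
    by (simp add: mm.minus_left matrix_mul_assoc mexp_commute)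
  from has_vector_derivative_zero_imp_eq[OF this, of s 0]
  have "mexp A s ** (mexp A (- s) ** mexp A (s + t)) = mexp A s ** mexp A t" by simp
  then show ?thesis
    using mexp_minus[of A "- s"] by (simp add: matrix_mul_assoc)
qed

lemma continuous_on_mexp [continuous_intros]:
  assumes "continuous_on S f" shows "continuous_on S (\<lambda>x. mexp A (f x))"
proof -
  have "continuous_on UNIV (mexp A)"
    using has_vector_derivative_continuous[OF mexp_has_vector_derivative]
    by (intro continuous_at_imp_continuous_on) blast
  then show ?thesis
    using assms by (rule continuous_on_compose2) simp
qed

lemma unitary_mexp:
  assumes "conj_transpose A = - A" shows "unitary (mexp A t)"
    and conj_transpose_mexp: "conj_transpose (mexp A t) = mexp A (- t)"
proof -
  have ct: "((\<lambda>t. conj_transpose (mexp A t)) has_vector_derivative conj_transpose (A ** mexp A t)) (at t)" for t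
    by (rule bounded_linear.has_vector_derivative[OF bounded_linear_conj_transpose
          mexp_has_vector_derivative])
  have "((\<lambda>t. conj_transpose (mexp A t) ** mexp A t) has_vector_derivative 0) (at t)" for t
    using mm.has_vector_derivative[OF ct mexp_has_vector_derivative[of A]]
    by (simp add: assms conj_transpose_mult mm.minus_right mm.minus_left matrix_mul_assoc)
  from has_vector_derivative_zero_imp_eq[OF this, of t 0]
  have *: "conj_transpose (mexp A t) ** mexp A t = mat 1" by simp
  have inv: "mexp A t ** mexp A (- t) = mat 1"
    using mexp_minus[of A "-t"] by simp
  have "conj_transpose (mexp A t) = (conj_transpose (mexp A t) ** mexp A t) ** mexp A (- t)"
    by (simp only: matrix_mul_assoc[symmetric] inv matrix_mul_rid)
  then show "conj_transpose (mexp A t) = mexp A (- t)" using * by simp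
  with * inv show "unitary (mexp A t)" by (simp add: unitary_def)
qed

text \<open>In the Leibniz formula the product rule differentiates one factor at a time. A
  permutation other than the identity moves at least two points, so an off-diagonal entry of the
  identity matrix survives and kills the term; the identity permutation contributes the
  trace.\<close>

lemma det_has_vector_derivative_at_mat_1:
  fixes f :: "real \<Rightarrow> complex^'n^'n"
  assumes "(f has_vector_derivative A) (at 0)" "f 0 = mat 1"
  shows "((\<lambda>t. det (f t)) has_vector_derivative trace A) (at 0)"
proof -
  have entry: "((\<lambda>t. f t $ i $ j) has_derivative (\<lambda>x. x *\<^sub>R A $ i $ j)) (at 0)" for i j
    using bounded_linear.has_vector_derivative[OF bounded_linear_compose[OF bounded_linear_vec_nth bounded_linear_vec_nth] assms(1)]
    by (simp add: has_vector_derivative_def)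
  let ?d = "\<lambda>p. \<Sum>i\<in>UNIV. A $ i $ p i * (\<Prod>j\<in>UNIV - {i}. mat 1 $ j $ p j)"
  have "((\<lambda>t. det (f t)) has_derivative
      (\<lambda>x. \<Sum>p | p permutes (UNIV::'n set). of_int (sign p) * (\<Sum>i\<in>UNIV. x *\<^sub>R A $ i $ p i *
          (\<Prod>j\<in>UNIV - {i}. f 0 $ j $ p j)))) (at 0)"
    unfolding det_def by (intro has_derivative_sum has_derivative_mult_right has_derivative_prod entry)
  then have "((\<lambda>t. det (f t)) has_derivative
      (\<lambda>x. x *\<^sub>R (\<Sum>p | p permutes (UNIV::'n set). of_int (sign p) * ?d p))) (at 0)"
    by (simp add: assms scaleR_sum_right sum_distrib_left)
  moreover have "?d p = 0" if p: "p permutes UNIV" "p \<noteq> id" for p :: "'n \<Rightarrow> 'n"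
  proof (rule sum.neutral, intro ballI)
    fix i
    obtain k where k: "p k \<noteq> k" using p by (auto simp: fun_eq_iff)
    \<comment> \<open>The point \<open>p k\<close> is a second moved point, so whichever index i is
      left out, a moved one remains.\<close>
    have "p (p k) \<noteq> p k" using k permutes_inj[OF p(1)] by (auto dest: injD)
    then obtain j where "j \<noteq> i" "p j \<noteq> j" using k by metis
    then show "A $ i $ p i * (\<Prod>j\<in>UNIV - {i}. mat 1 $ j $ p j) = 0"
      by (auto simp: mat_nth intro!: bexI[of _ j])
  qed
  then have "(\<Sum>p | p permutes (UNIV::'n set). of_int (sign p) * ?d p) =
      (\<Sum>p\<in>{id}. of_int (sign p) * ?d p)"
    by (intro sum.mono_neutral_right) (auto simp: permutes_id)
  moreover have "\<dots> = trace A"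
    by (simp add: trace_def mat_nth)
  ultimately show ?thesis
    by (simp add: has_vector_derivative_def)
qed

lemma det_mexp:
  assumes "trace A = 0" shows "det (mexp A t) = 1"
proof -
  have "((\<lambda>t. det (mexp A t)) has_vector_derivative 0) (at t)" for t
  proof -
    have "((\<lambda>s. det (mexp A s)) has_vector_derivative 0) (at 0)"
      using det_has_vector_derivative_at_mat_1[OF mexp_has_vector_derivative[of A 0]] assms by simp
    \<comment> \<open>The functional equation carries the derivative at time 0 to an arbitrary time
      t.\<close>
    then have "((\<lambda>s. det (mexp A (s - t)) * det (mexp A t)) has_vector_derivative 0) (at t)"
      using vector_diff_chain_at[of "\<lambda>s. s - t" 1 t "\<lambda>s. det (mexp A s)" 0]
        has_vector_derivative_mult_left[of _ 0 "at t" "det (mexp A t)"]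
      by (force intro!: derivative_eq_intros simp: o_def)
    then show ?thesis
      by (simp add: det_mul[symmetric] mexp_add[symmetric])
  qed
  from has_vector_derivative_zero_imp_eq[OF this, of t 0] show ?thesis by (simp add: det_I)
qed

lemma special_unitary_mexp: "A \<in> su \<Longrightarrow> special_unitary (mexp A t)"
  by (simp add: special_unitary_def su_def unitary_mexp det_mexp)

text \<open>Difference quotients stay in the subspace, and a subspace of a Euclidean space is
  closed.\<close>

lemma has_vector_derivative_in_subspace:
  fixes f :: "real \<Rightarrow> 'a::euclidean_space"
  assumes "subspace V" "\<And>t. f t \<in> V" "(f has_vector_derivative D) (at a)"
  shows "D \<in> V"
proof -
  have lim: "(\<lambda>h. norm (f (a + h) - f a - h *\<^sub>R D) / \<bar>h\<bar>) \<midarrow>0\<rightarrow> 0"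
    using assms(3) unfolding has_vector_derivative_def has_derivative_at by simp
  have "(\<lambda>h. norm ((f (a + h) - f a) /\<^sub>R h - D)) \<midarrow>0\<rightarrow> 0"
  proof (rule Lim_transform_within[OF lim, of 1])
    show "norm (f (a + h) - f a - h *\<^sub>R D) / \<bar>h\<bar> = norm ((f (a + h) - f a) /\<^sub>R h - D)"
      if "0 < dist h 0" for h
    proof -
      have "(f (a + h) - f a) /\<^sub>R h - D = (f (a + h) - f a - h *\<^sub>R D) /\<^sub>R h"
        using that by (simp add: algebra_simps)
      then show ?thesis by (simp add: divide_inverse_commute)
    qed
  qed simp
  then have "((\<lambda>h. (f (a + h) - f a) /\<^sub>R h) \<longlongrightarrow> D) (at 0)"
    by (simp add: tendsto_norm_zero_iff LIM_zero_iff)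
  then show ?thesis
    by (rule Lim_in_closed_set[OF closed_subspace[OF assms(1)], rotated 2])
       (auto intro!: always_eventually subspace_scale subspace_diff assms)
qed

lemma su_conjugate:
  assumes "A \<in> su" "unitary g" shows "g ** A ** conj_transpose g \<in> su"
proof -
  have "conj_transpose (g ** A ** conj_transpose g) = - (g ** A ** conj_transpose g)"
    using assms by (simp add: su_def conj_transpose_mult mm.minus_left mm.minus_right matrix_mul_assoc)
  moreover have "trace (g ** A ** conj_transpose g) = trace (conj_transpose g ** (g ** A))"
    by (rule trace_mult_commute)
  ultimately show ?thesis
    using assms by (simp add: su_def unitary_cancel_left)
qed

section \<open>The semigroup generated by a set of directions\<close>

text \<open>Times are strictly positive because the drift cannot be reversed, and the empty product
  is left out because the final time has to be positive. A new factor goes on the left: it is the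
  pulse that acts last.\<close>

inductive_set reach :: "(complex^'n^'n) set \<Rightarrow> (complex^'n^'n) set" for G where
  mexp: "A \<in> G \<Longrightarrow> t > 0 \<Longrightarrow> mexp A t \<in> reach G"
| step: "A \<in> G \<Longrightarrow> t > 0 \<Longrightarrow> s \<in> reach G \<Longrightarrow> mexp A t ** s \<in> reach G"

lemma reach_mult: "s \<in> reach G \<Longrightarrow> s' \<in> reach G \<Longrightarrow> s ** s' \<in> reach G"
proof (induction s rule: reach.induct)
  case (step A t s)
  then show ?case
    using reach.step[OF step(1,2), of "s ** s'"] by (simp add: matrix_mul_assoc)
qed (rule reach.step)

text \<open>The assumption \<open>generating\<close> is the Lie algebra rank condition, phrased
  through all bracket-closed subspaces containing \<open>G\<close> instead of a construction of the
  generated Lie algebra.\<close>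

locale generators =
  fixes G :: "(complex^'n^'n) set"
  assumes nonempty: "G \<noteq> {}"
    and subset_su: "G \<subseteq> su"
    and generating: "\<And>V. subspace V \<Longrightarrow> G \<subseteq> V \<Longrightarrow>
      (\<And>A B. A \<in> V \<Longrightarrow> B \<in> V \<Longrightarrow> A ** B - B ** A \<in> V) \<Longrightarrow> su \<subseteq> V"
begin

lemma special_unitary_reach: "s \<in> reach G \<Longrightarrow> special_unitary s"
  by (induction rule: reach.induct)
     (use subset_su in \<open>auto intro: special_unitary_mexp special_unitary_mult\<close>)

lemma reach_nonempty: "reach G \<noteq> {}"
  using nonempty reach.mexp[of _ G 1] by force

definition "C = closure (reach G)"

lemma closed_C: "closed C" by (simp add: C_def)

lemma reach_subset_C: "reach G \<subseteq> C" by (simp add: C_def closure_subset)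

lemma C_mult:
  assumes "g \<in> C" "h \<in> C" shows "g ** h \<in> C"
proof -
  obtain x where x: "\<And>n. x n \<in> reach G" "x \<longlonglongrightarrow> g"
    using assms(1) by (auto simp: C_def closure_sequential)
  obtain y where y: "\<And>n. y n \<in> reach G" "y \<longlonglongrightarrow> h"
    using assms(2) by (auto simp: C_def closure_sequential)
  have "(\<lambda>n. x n ** y n) \<longlonglongrightarrow> g ** h"
    by (intro mm.tendsto x y)
  moreover have "x n ** y n \<in> reach G" for n
    using x y by (intro reach_mult)
  ultimately show ?thesis
    unfolding C_def closure_sequential by (intro exI[of _ "\<lambda>n. x n ** y n"] conjI allI)
qed

lemma unitary_C: assumes "g \<in> C" shows "unitary g"
proof -
  have "reach G \<subseteq> {A. unitary A}"
    using special_unitary_reach by (simp add: subset_iff special_unitary_def)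
  then have "closure (reach G) \<subseteq> {A. unitary A}"
    by (rule closure_minimal) (rule compact_imp_closed[OF compact_unitary])
  then show ?thesis using assms unfolding C_def by blast
qed

lemma compact_C: "compact C"
proof -
  have "{A. unitary A} \<inter> C = C" using unitary_C by auto
  then show ?thesis
    using compact_Int_closed[OF compact_unitary closed_C] by simp
qed

lemma mpow_C: "g \<in> C \<Longrightarrow> mpow g (Suc n) \<in> C"
  by (induction n) (auto intro: C_mult)

text \<open>A closed subsemigroup of a compact group is a group, because powers of an element accumulate
  at the identity.\<close>

lemma conj_transpose_C:
  assumes g: "g \<in> C" shows "conj_transpose g \<in> C"
proof -
  have "\<And>n. mpow g (Suc n) \<in> C" using mpow_C[OF g] by blast
  then obtain l r where l: "l \<in> C" and r: "strict_mono r" and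
    lim: "((\<lambda>n. mpow g (Suc n)) \<circ> r) \<longlonglongrightarrow> l"
    using seq_compactE[OF compact_C[THEN compact_imp_seq_compact]] by (metis (no_types, lifting))
  define x where "x n = mpow g (Suc (r n))" for n
  have x: "x \<longlonglongrightarrow> l" using lim unfolding o_def x_def .
  \<comment> \<open>Going two places along the subsequence raises the exponent by at least two.
    After cancelling \<open>x n\<close> and one extra factor g a positive power of g is left, which
    is needed as the identity is not yet known to lie in \<open>C\<close>.\<close>
  have r2: "Suc (Suc (r n)) \<le> r (Suc (Suc n))" for n
    using strict_monoD[OF r, of n "Suc n"] strict_monoD[OF r, of "Suc n" "Suc (Suc n)"] by simp
  have xC: "x n \<in> C" for n
    unfolding x_def by (rule mpow_C[OF g])
  have mem: "x (Suc (Suc n)) ** conj_transpose (x n) ** conj_transpose g \<in> C" for n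
  proof -
    obtain k where k: "r (Suc (Suc n)) = Suc (Suc (r n)) + k"
      using le_Suc_ex[OF r2[of n]] by auto
    have "Suc (r (Suc (Suc n))) = Suc k + (1 + Suc (r n))"
      using k by simp
    then have "x (Suc (Suc n)) = mpow g (Suc k) ** (mpow g 1 ** x n)"
      unfolding x_def by (simp only: mpow_add)
    then have "x (Suc (Suc n)) = mpow g (Suc k) ** (g ** x n)"
      by simp
    then have "x (Suc (Suc n)) ** conj_transpose (x n) ** conj_transpose g =
        mpow g (Suc k) ** (g ** ((x n ** conj_transpose (x n)) ** conj_transpose g))"
      by (simp only: matrix_mul_assoc)
    also have "\<dots> = mpow g (Suc k)"
      using unitary_C[OF xC[of n]] unitary_C[OF g] unfolding unitary_def
      by (simp only: matrix_mul_lid matrix_mul_rid)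
    finally show ?thesis using mpow_C[OF g] by (simp only:)
  qed
  have "(\<lambda>n. x (Suc (Suc n)) ** conj_transpose (x n) ** conj_transpose g) \<longlonglongrightarrow>
      l ** conj_transpose l ** conj_transpose g"
    using x LIMSEQ_Suc[OF LIMSEQ_Suc[OF x]]
    by (intro mm.tendsto bounded_linear.tendsto[OF bounded_linear_conj_transpose] tendsto_const)
  then have "l ** conj_transpose l ** conj_transpose g \<in> C"
    by (rule closed_sequentially[OF closed_C mem])
  then show ?thesis
    using unitary_C[OF l] by (simp add: unitary_def)
qed

lemma mat_1_C: "mat 1 \<in> C"
proof -
  obtain g where g: "g \<in> C" using reach_nonempty reach_subset_C by auto
  then have "g ** conj_transpose g \<in> C" by (intro C_mult conj_transpose_C)
  then show ?thesis using unitary_C[OF g] by (simp add: unitary_def)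
qed

text \<open>In the closure time runs in both directions, since the inverse of an exponential is its
  conjugate transpose and \<open>C\<close> is closed under the latter.\<close>

lemma mexp_C:
  assumes "A \<in> G" shows "mexp A t \<in> C"
proof -
  have pos: "mexp A t \<in> C" if "t > 0" for t
    using reach.mexp[OF assms that] reach_subset_C by auto
  have "conj_transpose A = - A" using assms subset_su by (auto simp: su_def)
  then have "mexp A t = conj_transpose (mexp A (- t))"
    by (simp add: conj_transpose_mexp)
  then show ?thesis
    using pos[of t] conj_transpose_C[OF pos[of "- t"]] mat_1_C
    by (cases t "0::real" rule: linorder_cases) auto
qed

definition "orbit = {g ** A ** conj_transpose g | g A. g \<in> C \<and> A \<in> G}"

text \<open>Conjugating the one-parameter group of a direction gives the curve. Such curves serve
  twice: differentiating conjugations along them produces brackets, and they give the first-order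
  conditions at a maximum over \<open>C\<close>.\<close>

lemma orbit_curve:
  assumes "X \<in> orbit"
  obtains \<gamma> where "\<And>t. \<gamma> t \<in> C" "\<gamma> 0 = mat 1" "(\<gamma> has_vector_derivative X) (at 0)"
proof -
  obtain g A where X: "X = g ** A ** conj_transpose g" and g: "g \<in> C" and A: "A \<in> G"
    using assms by (auto simp: orbit_def)
  have "((\<lambda>t. g ** mexp A t ** conj_transpose g) has_vector_derivative g ** (A ** mexp A 0) ** conj_transpose g) (at 0)"
    by (intro bounded_linear.has_vector_derivative[OF mm.bounded_linear_left]
        bounded_linear.has_vector_derivative[OF mm.bounded_linear_right] mexp_has_vector_derivative)
  then show thesis
    using that[of "\<lambda>t. g ** mexp A t ** conj_transpose g"] g A unitary_C[OF g] mexp_C conj_transpose_C C_mult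
    by (simp add: X unitary_def)
qed

text \<open>The span of the orbit is invariant under conjugation by \<open>C\<close>; differentiating such conjugations
  shows that it is closed under commutators.\<close>

lemma su_subset_span_orbit: "su \<subseteq> span orbit"
proof (rule generating)
  show "G \<subseteq> span orbit"
  proof
    fix A assume "A \<in> G"
    then have "mat 1 ** A ** conj_transpose (mat 1) \<in> orbit"
      unfolding orbit_def using mat_1_C by blast
    then show "A \<in> span orbit" by (simp add: span_base)
  qed
  have conj: "g ** Y ** conj_transpose g \<in> span orbit" if g: "g \<in> C" and Y: "Y \<in> span orbit" for g Y
  proof -
    have "linear (\<lambda>Y. g ** Y ** conj_transpose g)"
      by (simp add: linear_iff mm.add_left mm.add_right mm.scaleR_left mm.scaleR_right)
    moreover have "(\<lambda>Y. g ** Y ** conj_transpose g) ` orbit \<subseteq> orbit"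
      using C_mult[OF g] unfolding orbit_def
      by (force simp: conj_transpose_mult matrix_mul_assoc)
    ultimately have "(\<lambda>Y. g ** Y ** conj_transpose g) ` span orbit \<subseteq> span orbit"
      by (metis linear_span_image span_mono)
    then show ?thesis using Y by auto
  qed
  \<comment> \<open>Only X has to come with a curve; Y may be anything in the span, which is
    invariant under conjugation. Linearity in X finishes the argument.\<close>
  have base: "X ** Y - Y ** X \<in> span orbit" if X: "X \<in> orbit" and Y: "Y \<in> span orbit" for X Y
  proof -
    obtain \<gamma> where \<gamma>: "\<And>t. \<gamma> t \<in> C" "\<gamma> 0 = mat 1" "(\<gamma> has_vector_derivative X) (at 0)"
      using orbit_curve[OF X] by blast
    have "X \<in> su"
      using X subset_su unitary_C by (auto simp: orbit_def intro!: su_conjugate)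
    then have "conj_transpose X = - X" by (simp add: su_def)
    moreover have "((\<lambda>t. \<gamma> t ** Y ** conj_transpose (\<gamma> t)) has_vector_derivative
       \<gamma> 0 ** Y ** conj_transpose X + X ** Y ** conj_transpose (\<gamma> 0)) (at 0)"
      by (intro mm.has_vector_derivative bounded_linear.has_vector_derivative[OF mm.bounded_linear_left]
          bounded_linear.has_vector_derivative[OF bounded_linear_conj_transpose] \<gamma>)
    ultimately have "((\<lambda>t. \<gamma> t ** Y ** conj_transpose (\<gamma> t)) has_vector_derivative X ** Y - Y ** X) (at 0)"
      by (simp add: \<gamma>(2) mm.minus_right)
    then show ?thesis
      by (rule has_vector_derivative_in_subspace[OF subspace_span conj[OF \<gamma>(1) Y]])
  qed
  show "X ** Y - Y ** X \<in> span orbit" if "X \<in> span orbit" "Y \<in> span orbit" for X Y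
    using that(1)
  proof (induction rule: span_induct_alt)
    case (step c X Z)
    have "(c *\<^sub>R X + Z) ** Y - Y ** (c *\<^sub>R X + Z) = c *\<^sub>R (X ** Y - Y ** X) + (Z ** Y - Y ** Z)"
      by (simp add: mm.add_left mm.add_right mm.scaleR_left mm.scaleR_right algebra_simps)
    then show ?case
      using step base[OF step(1) that(2)] by (simp add: span_add span_scale)
  qed (simp add: span_zero mm.zero_left mm.zero_right)
qed simp

end

context generators
begin

section \<open>From density to exact reachability\<close>

text \<open>Products with free switching times, parametrised by the matrix space itself: domain and
  codomain have equal dimension, so a derivative that misses a direction has a kernel. Continuity
  near 0 and differentiability at 0 alone are what the open mapping theorem used later asks
  for.\<close>

definition chart :: "real \<Rightarrow> (complex^'n^'n \<Rightarrow> complex^'n^'n) \<Rightarrow> (complex^'n^'n \<Rightarrow> complex^'n^'n) \<Rightarrow> bool" where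
  "chart r F D \<longleftrightarrow> r > 0 \<and> continuous_on (ball 0 r) F \<and> (\<forall>x\<in>ball 0 r. F x \<in> reach G) \<and>
     (F has_derivative D) (at 0)"

text \<open>A chart whose derivative misses a direction \<open>s A s\<^sup>*\<close> of the orbit (translated to \<open>F 0\<close>) can be
  composed with a motion along \<open>A\<close>, with the new time driven by a kernel direction \<open>e\<close> of \<open>D\<close>; this
  raises the rank. So a chart of maximal rank sees the whole orbit.\<close>

lemma chart_extend:
  assumes F: "chart r F D" and s: "s \<in> reach G" and A: "A \<in> G"
    and notin: "F 0 ** s ** A ** conj_transpose s \<notin> range D"
  shows "\<exists>r F' D'. chart r F' D' \<and> dim (range D) < dim (range D')"
proof -
  have r: "r > 0" and cont: "continuous_on (ball 0 r) F" and mem: "\<And>x. x \<in> ball 0 r \<Longrightarrow> F x \<in> reach G"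
    and der: "(F has_derivative D) (at 0)"
    using F by (auto simp: chart_def)
  have lin: "linear D" using der by (rule has_derivative_linear)
  have "\<not> inj D"
    using notin linear_injective_imp_surjective[OF lin] by auto
  then obtain e' where e': "e' \<noteq> 0" "D e' = 0"
    using linear_injective_0[OF lin] by auto
  define e where "e = e' /\<^sub>R norm e'"
  have e: "e \<bullet> e = 1" "D e = 0"
    using e' by (simp_all add: e_def linear_scale[OF lin] power2_norm_eq_inner[symmetric] power2_eq_square)
  then have ne: "norm e = 1" by (simp add: norm_eq_1)
  define E where "E = mexp A 1"
  have us: "unitary s" and uE: "unitary E"
    using special_unitary_reach[OF s] special_unitary_mexp[of A 1] A subset_su
    by (auto simp: special_unitary_def E_def)
  \<comment> \<open>The new pulse lasts \<open>1 + x \<bullet> e\<close>, which stays positive for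
    \<open>norm x < 1\<close> because e is a unit vector.\<close>
  define F' where "F' x = F x ** s ** mexp A (1 + x \<bullet> e)" for x
  define D' where "D' x = D x ** s ** E + (x \<bullet> e) *\<^sub>R (F 0 ** s ** (A ** E))" for x
  have "chart (min r 1) F' D'"
    unfolding chart_def
  proof (intro conjI ballI)
    show "min r 1 > 0" using r by simp
    show "continuous_on (ball 0 (min r 1)) F'"
      unfolding F'_def
      by (intro mm.continuous_on continuous_intros continuous_on_subset[OF cont]) auto
    show "F' x \<in> reach G" if "x \<in> ball 0 (min r 1)" for x
    proof -
      have "norm x < 1" "x \<in> ball 0 r" using that by auto
      moreover have "\<bar>x \<bullet> e\<bar> \<le> norm x" using Cauchy_Schwarz_ineq2[of x e] ne by simp
      ultimately show ?thesis
        unfolding F'_def using A s mem by (intro reach_mult reach.mexp) auto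
    qed
    have m: "((\<lambda>x. mexp A (1 + x \<bullet> e)) has_derivative (\<lambda>x. (x \<bullet> e) *\<^sub>R (A ** E))) (at 0)"
    proof -
      have "(mexp A has_derivative (\<lambda>x. x *\<^sub>R (A ** mexp A 1))) (at (1 + 0 \<bullet> e))"
        using mexp_has_vector_derivative[of A 1] by (simp add: has_vector_derivative_def)
      moreover have "((\<lambda>x. 1 + x \<bullet> e) has_derivative (\<lambda>x. x \<bullet> e)) (at 0)"
        by (auto intro!: derivative_eq_intros)
      ultimately show ?thesis
        unfolding E_def by (rule has_derivative_compose[rotated])
    qed
    have "((\<lambda>x. F x ** s) has_derivative (\<lambda>x. D x ** s)) (at 0)"
      by (rule bounded_linear.has_derivative[OF mm.bounded_linear_left der])
    from mm.FDERIV[OF this m] show "(F' has_derivative D') (at 0)"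
      unfolding F'_def D'_def by (simp add: E_def mm.scaleR_right add.commute)
  qed
  moreover have "dim (range D) < dim (range D')"
  proof -
    let ?R = "\<lambda>X. X ** s ** E"
    have linR: "linear ?R"
      by (simp add: linear_iff mm.add_left mm.scaleR_left)
    have injR: "?R X = ?R Y \<Longrightarrow> X = Y" for X Y
    proof -
      assume "?R X = ?R Y"
      then have "?R X ** conj_transpose E ** conj_transpose s = ?R Y ** conj_transpose E ** conj_transpose s"
        by simp
      then show "X = Y" using us uE by (simp add: matrix_mul_assoc[symmetric] unitary_cancel_left' unitary_def)
    qed
    have lin': "linear D'"
      using \<open>chart (min r 1) F' D'\<close> by (auto simp: chart_def dest: has_derivative_linear)
    have sub: "?R ` range D \<subseteq> range D'"
    proof clarify
      fix x
      \<comment> \<open>Removing the component along e switches off the new term and does not change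
        the old one, as \<open>D e = 0\<close>. The old range, translated by \<open>s ** E\<close>,
        therefore persists.\<close>
      have "D' (x - (x \<bullet> e) *\<^sub>R e) = ?R (D x)"
        using e by (simp add: D'_def inner_diff_left linear_diff[OF lin] linear_scale[OF lin])
      then show "?R (D x) \<in> range D'" by (metis rangeI)
    qed
    moreover have "D' e \<notin> ?R ` range D"
    proof
      assume "D' e \<in> ?R ` range D"
      then obtain x where "F 0 ** s ** (A ** E) = D x ** s ** E"
        using e by (auto simp: D'_def mm.zero_left)
      then have "F 0 ** s ** (A ** E) ** conj_transpose E ** conj_transpose s =
          D x ** s ** E ** conj_transpose E ** conj_transpose s" by simp
      then have "F 0 ** s ** A ** conj_transpose s = D x"
        using us uE by (simp add: matrix_mul_assoc[symmetric] unitary_cancel_left' unitary_def)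
      then show False using notin by auto
    qed
    ultimately have "?R ` range D \<subset> range D'" by auto
    moreover have "subspace (?R ` range D)" "subspace (range D')"
      by (intro linear_subspace_image linR lin lin' subspace_UNIV)+
    ultimately have "dim (?R ` range D) < dim (range D')"
      by (intro dim_psubset) (simp only: span_eq_iff[THEN iffD2])
    moreover have "dim (?R ` range D) = dim (range D)"
      using linR injR by (intro dim_image_eq inj_onI) auto
    ultimately show ?thesis by simp
  qed
  ultimately show ?thesis by blast
qed

text \<open>Ranks are bounded by the dimension of the matrix space, so a chart of greatest rank
  exists. Its range contains the translated conjugates by elements of \<open>reach G\<close>, and,
  being closed, those by elements of \<open>C\<close>; linearity extends this to the span of the
  orbit.\<close>

lemma chart_su:
  obtains r F D where "chart r F D" "\<And>X. X \<in> su \<Longrightarrow> F 0 ** X \<in> range D"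
proof -
  let ?P = "\<lambda>k. \<exists>r F D. chart r F D \<and> dim (range D) = k"
  obtain s where "s \<in> reach G" using reach_nonempty by auto
  \<comment> \<open>A constant chart, of rank 0, shows that the maximum is over a nonempty
    set.\<close>
  then have "chart 1 (\<lambda>_. s) (\<lambda>_. 0)" by (simp add: chart_def)
  then have ex: "\<exists>k. ?P k" by blast
  have bound: "\<And>k. ?P k \<Longrightarrow> k \<le> DIM(complex^'n^'n)"
    using dim_subset_UNIV by blast
  obtain r F D where F: "chart r F D" and k: "dim (range D) = (GREATEST k. ?P k)"
    using GreatestI_ex_nat[of ?P, OF ex bound] by blast
  have max: "dim (range D') \<le> dim (range D)" if "chart r' F' D'" for r' F' D'
    unfolding k using that bound by (intro Greatest_le_nat[of ?P]) blast+
  have D: "subspace (range D)"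
    using F by (auto simp: chart_def intro!: linear_subspace_image dest: has_derivative_linear)
  have reach: "F 0 ** s ** A ** conj_transpose s \<in> range D" if "s \<in> reach G" "A \<in> G" for s A
    using chart_extend[OF F that] max by (meson leD)
  have C: "F 0 ** g ** A ** conj_transpose g \<in> range D" if "g \<in> C" "A \<in> G" for g A
  proof -
    obtain x where x: "\<And>n. x n \<in> reach G" "x \<longlonglongrightarrow> g"
      using \<open>g \<in> C\<close> by (auto simp: C_def closure_sequential)
    have "(\<lambda>n. F 0 ** x n ** A ** conj_transpose (x n)) \<longlonglongrightarrow> F 0 ** g ** A ** conj_transpose g"
      by (intro mm.tendsto bounded_linear.tendsto[OF bounded_linear_conj_transpose] x tendsto_const)
    then show ?thesis
      by (rule closed_sequentially[OF closed_subspace[OF D] reach[OF x(1) that(2)]])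
  qed
  let ?V = "{X. F 0 ** X \<in> range D}"
  have "subspace ?V"
    using D by (auto simp: subspace_def mm.add_right mm.scaleR_right mm.zero_right)
  moreover have "orbit \<subseteq> ?V"
    using C by (auto simp: orbit_def matrix_mul_assoc)
  ultimately have "su \<subseteq> ?V"
    using su_subset_span_orbit span_minimal by blast
  then show thesis using that[OF F] by auto
qed

end

text \<open>The scalar imaginary matrices and the self-adjoint matrices span a complement of \<open>su\<close>;
  near the identity this complement meets the special unitary group only in the identity.\<close>

definition transversal :: "complex^'n^'n \<Rightarrow> complex^'n^'n" where
  "transversal B = (1/2) *\<^sub>R (B + conj_transpose B) + mat (\<i> * of_real (Im (trace B) / of_nat CARD('n)))"

text \<open>Write the matrix as J + \<i>\<theta> with J self-adjoint. Unitarity says that J squared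
  is the scalar 1 - \<theta>^2 = c^2. For J = c + Y this reads 2cY = -Y^2, which forces Y = 0 when Y
  is small. The matrix is then a scalar z with z^N = 1, and roots of unity near 1 equal 1.\<close>

lemma special_unitary_transversal:
  "\<exists>\<epsilon>>0. \<forall>B. norm (transversal B) < \<epsilon> \<longrightarrow> special_unitary (mat 1 + transversal B) \<longrightarrow>
    transversal (B :: complex^'n^'n) = 0"
proof -
  let ?N = "CARD('n)"
  have "finite {z::complex. z ^ ?N = 1}"
    by (rule finite_roots_unity) (simp add: Suc_leI)
  then obtain d where d: "d > 0" "\<And>z::complex. z ^ ?N = 1 \<Longrightarrow> z \<noteq> 1 \<Longrightarrow> d \<le> dist 1 z"
    using finite_set_avoid[of "{z::complex. z ^ ?N = 1}" 1] by auto
  obtain K where K: "K > 0" "\<And>(A :: complex^'n^'n) (B :: complex^'n^'n). norm (A ** B) \<le> norm A * norm B * K"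
    using mm.pos_bounded by blast
  define m where "m = norm (mat 1 :: complex^'n^'n) + norm (mat \<i> :: complex^'n^'n)"
  have m: "norm (mat (Complex a b) :: complex^'n^'n) \<le> \<bar>a\<bar> * m + \<bar>b\<bar> * m" for a b
  proof -
    have "mat (Complex a b) = a *\<^sub>R mat 1 + b *\<^sub>R (mat \<i> :: complex^'n^'n)"
      by (simp add: vec_eq_iff mat_nth complex_eq_iff)
    then have "norm (mat (Complex a b) :: complex^'n^'n) \<le>
        \<bar>a\<bar> * norm (mat 1 :: complex^'n^'n) + \<bar>b\<bar> * norm (mat \<i> :: complex^'n^'n)"
      by (metis norm_scaleR norm_triangle_ineq)
    also have "\<dots> \<le> \<bar>a\<bar> * m + \<bar>b\<bar> * m"
      by (intro add_mono mult_left_mono) (simp_all add: m_def)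
    finally show ?thesis .
  qed
  have "m \<ge> 0" by (simp add: m_def)
  \<comment> \<open>The bound 1/2 gives 2c > 1, the bound d/2 places z closer to 1 than any other
    root of unity, and the last one yields \<open>norm Y * K < 1\<close>, so that 2cY = -Y^2 has
    only the zero solution in range.\<close>
  define \<epsilon> where "\<epsilon> = min (1/2) (min (d / 2) (1 / (K * (1 + 2 * m))))"
  have \<epsilon>: "\<epsilon> > 0"
    using d(1) K(1) \<open>m \<ge> 0\<close> by (simp add: \<epsilon>_def)
  have main: "h + mat (\<i> * of_real \<theta>) = 0"
    if h: "conj_transpose h = h" and n: "norm (h + mat (\<i> * of_real \<theta>)) < \<epsilon>"
      and Q: "special_unitary (mat 1 + (h + mat (\<i> * of_real \<theta>)))" for h :: "complex^'n^'n" and \<theta>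
  proof -
    let ?P = "h + mat (\<i> * of_real \<theta>)"
    define c where "c = sqrt (1 - \<theta>\<^sup>2)"
    \<comment> \<open>The diagonal of the self-adjoint h is real, so \<theta> is the imaginary part
      of any diagonal entry.\<close>
    have "\<bar>\<theta>\<bar> \<le> norm ?P"
    proof -
      fix j
      have "cnj (h $ j $ j) = h $ j $ j"
        using h by (metis conj_transpose_nth)
      then have "Im (?P $ j $ j) = \<theta>"
        by (simp add: mat_nth complex_eq_iff)
      then show ?thesis
        using abs_Im_le_cmod[of "?P $ j $ j"] norm_entry_le[of ?P j j] by simp
    qed
    then have \<theta>: "\<bar>\<theta>\<bar> < \<epsilon>" using n by simp
    have "\<theta>\<^sup>2 \<le> \<bar>\<theta>\<bar> / 2"
      using \<theta> mult_left_mono[of "\<bar>\<theta>\<bar>" "1/2" "\<bar>\<theta>\<bar>"] by (simp add: \<epsilon>_def power2_eq_square)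
    then have \<theta>2: "\<theta>\<^sup>2 \<le> \<bar>\<theta>\<bar>" "\<theta>\<^sup>2 < 1/2"
      using \<theta> by (auto simp: \<epsilon>_def)
    have c2: "c * c = 1 - \<theta>\<^sup>2"
      using \<theta>2 by (simp add: c_def)
    have c1: "c \<ge> 1 - \<theta>\<^sup>2" "c \<le> 1"
    proof -
      show "c \<le> 1" by (simp add: c_def)
      then show "c \<ge> 1 - \<theta>\<^sup>2"
        using c2 mult_left_mono[of c 1 c] \<theta>2 by (simp add: c_def)
    qed
    have cpos: "0 \<le> 2 * c" using c1 \<theta>2 by simp
    define J where "J = mat 1 + h"
    have "(J + mat (\<i> * of_real \<theta>)) ** (J - mat (\<i> * of_real \<theta>)) = mat 1"
    proof -
      have "conj_transpose (J + mat (\<i> * of_real \<theta>)) = J - mat (\<i> * of_real \<theta>)"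
        using h by (simp add: J_def conj_transpose_linear vec_eq_iff mat_nth)
      then show ?thesis
        using Q by (simp add: special_unitary_def unitary_def J_def add.assoc)
    qed
    then have "J ** J - mat (\<i> * of_real \<theta>) ** mat (\<i> * of_real \<theta>) = mat 1"
      by (simp add: mm.add_left mm.diff_right mat_mult_commute[of J] algebra_simps)
    then have JJ: "J ** J = mat (of_real (c * c))"
      unfolding c2 mat_mat by (simp add: vec_eq_iff mat_nth power2_eq_square algebra_simps)
    define Y where "Y = J - mat (of_real c)"
    have "(2 * c) *\<^sub>R Y = - (Y ** Y)"
    proof -
      have "Y ** Y = J ** J - mat (of_real c) ** J - mat (of_real c) ** J + mat (of_real c) ** mat (of_real c)"
        by (simp add: Y_def mm.diff_left mm.diff_right mat_mult_commute[of J] algebra_simps)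
      then show ?thesis
        unfolding JJ mat_mat scaleR_eq_mat[of "2 * c"]
        by (simp add: Y_def mm.diff_right vec_eq_iff) (simp add: mat_nth algebra_simps)
    qed
    then have "2 * c * norm Y = norm (Y ** Y)"
      using c1 \<theta>2 by (metis abs_of_nonneg cpos norm_minus_cancel norm_scaleR)
    also have "\<dots> \<le> norm Y * norm Y * K" by (rule K(2))
    finally have le: "norm Y * (2 * c) \<le> norm Y * (norm Y * K)" by (simp add: mult_ac)
    have "Y = ?P + mat (Complex (1 - c) (- \<theta>))"
      by (simp add: Y_def J_def vec_eq_iff mat_nth complex_eq_iff)
    then have "norm Y \<le> norm ?P + (\<bar>1 - c\<bar> * m + \<bar>- \<theta>\<bar> * m)"
      using norm_triangle_mono[OF order_refl m, of ?P "1 - c" "- \<theta>"] by (simp only:)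
    also have "\<dots> \<le> norm ?P + (\<bar>\<theta>\<bar> * m + \<bar>\<theta>\<bar> * m)"
      using c1 \<theta>2 \<open>m \<ge> 0\<close> by (intro add_mono mult_right_mono order_refl) auto
    also have "\<dots> < \<epsilon> + (\<epsilon> * m + \<epsilon> * m)"
      using n \<theta> \<open>m \<ge> 0\<close> by (intro add_less_le_mono add_mono mult_right_mono) auto
    also have "\<dots> = \<epsilon> * (1 + 2 * m)" by (simp add: algebra_simps)
    also have "\<dots> \<le> 1 / (K * (1 + 2 * m)) * (1 + 2 * m)"
      using \<open>m \<ge> 0\<close> by (intro mult_right_mono) (simp_all add: \<epsilon>_def)
    also have "\<dots> = 1 / K" using \<open>m \<ge> 0\<close> K(1) by (simp add: divide_simps)
    finally have "norm Y * K < 1" using K(1) by (simp add: divide_simps)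
    then have "\<not> 2 * c \<le> norm Y * K" using c1 \<theta>2 by simp
    with le have "\<not> 0 < norm Y" using mult_le_cancel_left_pos by blast
    then have "Y = 0" by simp
    then have J: "J = mat (of_real c)" by (simp add: Y_def)
    define z where "z = Complex c \<theta>"
    have Qz: "mat 1 + ?P = mat z"
    proof -
      have "mat z = mat (of_real c) + (mat (\<i> * of_real \<theta>) :: complex^'n^'n)"
        by (simp add: z_def vec_eq_iff mat_nth complex_eq_iff)
      then show ?thesis using J by (simp add: J_def add.assoc)
    qed
    have "det (mat z :: complex^'n^'n) = z ^ ?N"
      by (subst det_diagonal) (auto simp: mat_nth)
    then have "z ^ ?N = 1"
      using Q Qz by (simp add: special_unitary_def)
    moreover have "dist 1 z < d"
    proof -
      have "dist 1 z \<le> \<bar>Re (1 - z)\<bar> + \<bar>Im (1 - z)\<bar>"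
        unfolding dist_norm by (rule cmod_le)
      also have "\<dots> \<le> 2 * \<bar>\<theta>\<bar>" using c1 \<theta>2 by (simp add: z_def)
      also have "\<dots> < d" using \<theta> by (simp add: \<epsilon>_def)
      finally show ?thesis .
    qed
    ultimately have "z = 1" using d(2)[of z] by fastforce
    then show ?thesis using Qz by simp
  qed
  have "transversal B = 0"
    if "norm (transversal B) < \<epsilon>" "special_unitary (mat 1 + transversal B)" for B :: "complex^'n^'n"
    using that unfolding transversal_def
    by (intro main) (simp_all add: conj_transpose_linear add.commute)
  then show ?thesis using \<epsilon> by blast
qed

lemma linear_transversal: "linear transversal"
proof (rule linearI)
  fix A B :: "complex^'a^'a" and r
  show "transversal (A + B) = transversal A + transversal B"
    by (simp add: transversal_def conj_transpose_linear linear_add[OF linear_trace] vec_eq_iff)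
       (simp add: mat_nth scaleR_conv_of_real field_simps)
  show "transversal (r *\<^sub>R A) = r *\<^sub>R transversal A"
    by (simp add: transversal_def conj_transpose_linear trace_scaleR vec_eq_iff)
       (simp add: mat_nth scaleR_conv_of_real field_simps)
qed

text \<open>What remains is the skew-adjoint part of B with its mean diagonal entry subtracted, so
  \<open>transversal\<close> is the projection along \<open>su\<close>.\<close>

lemma minus_transversal_su: "B - transversal B \<in> su" for B :: "complex^'n^'n"
proof -
  have "conj_transpose (B - transversal B) = - (B - transversal B)"
    by (simp add: transversal_def conj_transpose_linear vec_eq_iff)
       (simp add: mat_nth scaleR_conv_of_real field_simps)
  moreover have "trace (B - transversal B) = 0"
    by (simp add: transversal_def trace_add trace_sub trace_scaleR trace_conj_transpose trace_mat complex_eq_iff)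
  ultimately show ?thesis by (simp add: su_def)
qed

context generators
begin

text \<open>The map F(x)(1 + L(y)), with L the projection \<open>transversal\<close>, has surjective
  derivative at 0: the chart supplies the directions in \<open>su\<close>, the second factor its
  complement. Hence every matrix near \<open>F 0\<close> is such a product. If it is special
  unitary, so is 1 + L(y), which is then the identity, and the matrix is F(x) itself.\<close>

lemma reach_contains_ball:
  obtains s \<delta> where "s \<in> reach G" "\<delta> > 0"
    "\<And>\<Gamma>. special_unitary \<Gamma> \<Longrightarrow> dist \<Gamma> s < \<delta> \<Longrightarrow> \<Gamma> \<in> reach G"
proof -
  obtain r F D where F: "chart r F D" and D: "\<And>X. X \<in> su \<Longrightarrow> F 0 ** X \<in> range D"
    using chart_su by blast
  have r: "r > 0" and cont: "continuous_on (ball 0 r) F" and mem: "\<And>x. x \<in> ball 0 r \<Longrightarrow> F x \<in> reach G"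
    and der: "(F has_derivative D) (at 0)"
    using F by (auto simp: chart_def)
  have F0: "F 0 \<in> reach G" using mem r by simp
  have uF0: "unitary (F 0)" using special_unitary_reach[OF F0] by (simp add: special_unitary_def)
  obtain \<epsilon> where \<epsilon>: "\<epsilon> > 0" and iso: "\<And>B :: complex^'n^'n. norm (transversal B) < \<epsilon> \<Longrightarrow>
      special_unitary (mat 1 + transversal B) \<Longrightarrow> transversal B = 0"
    using special_unitary_transversal by blast
  let ?L = "transversal :: complex^'n^'n \<Rightarrow> complex^'n^'n"
  have L: "bounded_linear ?L"
    using linear_transversal by (rule linear_conv_bounded_linear[THEN iffD1])
  have L0: "?L 0 = 0" by (rule linear_0[OF linear_transversal])
  have cL: "continuous_on A (\<lambda>p. ?L (snd p))" for A :: "((complex^'n^'n) \<times> (complex^'n^'n)) set"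
    by (intro bounded_linear.continuous_on[OF L] continuous_intros)
  define F' where "F' p = F (fst p) ** (mat 1 + ?L (snd p))" for p
  define D' where "D' p = D (fst p) + F 0 ** ?L (snd p)" for p
  define S where "S = (ball 0 r :: (complex^'n^'n) set) \<times> (UNIV :: (complex^'n^'n) set)"
  \<comment> \<open>The open mapping theorem is applied on this smaller set so that the second
    factor stays where \<open>iso\<close> applies.\<close>
  define T where "T = {p \<in> S. norm (?L (snd p)) < \<epsilon>}"
  have S: "open S" by (simp add: S_def open_Times)
  have "T = S \<inter> (\<lambda>p. norm (?L (snd p))) -` {..<\<epsilon>}" by (auto simp: T_def)
  then have T: "open T"
    using continuous_openin_preimage_gen[of S "\<lambda>p. norm (?L (snd p))" "{..<\<epsilon>}"]
      S openin_open_eq[OF S] continuous_on_norm[OF cL] by simp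
  have contF': "continuous_on S F'"
    unfolding F'_def S_def
    by (intro mm.continuous_on continuous_on_add continuous_on_const cL
        continuous_on_compose2[OF cont] continuous_on_fst continuous_on_id) auto
  have derF': "(F' has_derivative D') (at 0)"
  proof -
    have "((\<lambda>p :: (complex^'n^'n) \<times> (complex^'n^'n). F (fst p)) has_derivative (\<lambda>p. D (fst p))) (at 0)"
      by (rule has_derivative_compose[OF bounded_linear_imp_has_derivative[OF bounded_linear_fst]])
         (simp add: der)
    from mm.FDERIV[OF this, of "\<lambda>p. mat 1 + ?L (snd p)" "\<lambda>p. ?L (snd p)"]
    have *: "((\<lambda>p :: (complex^'n^'n) \<times> (complex^'n^'n). mat 1 + ?L (snd p)) has_derivative (\<lambda>p. ?L (snd p))) (at 0) \<Longrightarrow> ?thesis"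
      by (simp add: F'_def[abs_def] D'_def[abs_def] L0 add.commute)
    have "((\<lambda>p :: (complex^'n^'n) \<times> (complex^'n^'n). mat 1 + ?L (snd p)) has_derivative (\<lambda>p. ?L (snd p))) (at 0)"
      using has_derivative_add[OF has_derivative_const
          bounded_linear_imp_has_derivative[OF bounded_linear_compose[OF L bounded_linear_snd]], of "mat 1" "at 0"]
      by simp
    then show ?thesis by (rule *)
  qed
  have "linear D'" using derF' by (rule has_derivative_linear)
  moreover have "surj D'"
    unfolding surj_def
  proof
    fix Y :: "complex^'n^'n"
    let ?B = "conj_transpose (F 0) ** Y"
    \<comment> \<open>Pulled back by \<open>F 0\<close>, the target splits into a part in
      \<open>su\<close>, reached by the chart, and a transversal part, supplied by the second
      coordinate.\<close>
    obtain x where "F 0 ** (?B - ?L ?B) = D x"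
      using D[OF minus_transversal_su[of ?B]] by blast
    then have "Y = D' (x, ?B)"
      using unitary_cancel_left'[OF uF0, of Y] by (simp add: D'_def mm.diff_right algebra_simps)
    then show "\<exists>p. Y = D' p" by blast
  qed
  ultimately obtain g where g: "linear g" "D' \<circ> g = id"
    using linear_surjective_right_inverse by blast
  have "F' 0 \<in> interior (F' ` T)"
  proof (rule sussmann_open_mapping[OF S contF' _ derF' _ g(2)])
    show "0 \<in> S" using r by (simp add: S_def zero_prod_def)
    then show "0 \<in> interior T" using \<epsilon> L0 T by (simp add: interior_open T_def)
    show "bounded_linear g" using g(1) by (simp add: linear_conv_bounded_linear)
    show "T \<subseteq> S" by (auto simp: T_def)
  qed
  then obtain \<delta> where \<delta>: "\<delta> > 0" "ball (F 0) \<delta> \<subseteq> F' ` T"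
    by (auto simp: mem_interior F'_def L0)
  have "\<Gamma> \<in> reach G" if su: "special_unitary \<Gamma>" and "dist \<Gamma> (F 0) < \<delta>" for \<Gamma>
  proof -
    have "\<Gamma> \<in> F' ` T"
      using \<delta>(2) that(2) by (auto simp: dist_commute)
    then obtain p where p: "p \<in> T" "\<Gamma> = F (fst p) ** (mat 1 + ?L (snd p))"
      by (auto simp: F'_def)
    have Fp: "F (fst p) \<in> reach G" using p(1) mem by (auto simp: T_def S_def)
    then have sF: "special_unitary (F (fst p))" by (rule special_unitary_reach)
    have "mat 1 + ?L (snd p) = conj_transpose (F (fst p)) ** \<Gamma>"
      using sF by (simp add: p(2) special_unitary_def unitary_cancel_left)
    then have "special_unitary (mat 1 + ?L (snd p))"
      using su sF by (simp add: special_unitary_mult special_unitary_conj_transpose)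
    moreover have "norm (?L (snd p)) < \<epsilon>" using p(1) by (simp add: T_def)
    ultimately have "?L (snd p) = 0" by (intro iso)
    then show ?thesis using p(2) Fp by simp
  qed
  then show thesis by (rule that[OF F0 \<delta>(1)])
qed

end

section \<open>Density of the semigroup: diagonal matrices and stationary points\<close>

definition diag :: "('n \<Rightarrow> complex) \<Rightarrow> complex^'n^'n" where
  "diag d = (\<chi> i j. if i = j then d i else 0)"

lemma diag_mult_nth [simp]: "(diag d ** A) $ i $ j = d i * A $ i $ j"
proof -
  have "(diag d ** A) $ i $ j = (\<Sum>k\<in>UNIV. if k = i then d i * A $ k $ j else 0)"
    unfolding mat_mult_nth by (rule sum.cong) (auto simp: diag_def)
  then show ?thesis by simp
qed

lemma mult_diag_nth [simp]: "(A ** diag d) $ i $ j = A $ i $ j * d j"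
proof -
  have "(A ** diag d) $ i $ j = (\<Sum>k\<in>UNIV. if k = j then A $ i $ k * d j else 0)"
    unfolding mat_mult_nth by (rule sum.cong) (auto simp: diag_def)
  then show ?thesis by simp
qed

lemma diag_diag: "diag a ** diag b = diag (\<lambda>i. a i * b i)"
  by (simp add: vec_eq_iff) (simp add: diag_def)

lemma mpow_diag: "mpow (diag d) n = diag (\<lambda>i. d i ^ n)"
proof (induction n)
  case 0
  then show ?case by (simp add: diag_def mat_def vec_eq_iff)
qed (simp add: diag_diag)

lemma det_diag: "det (diag d) = (\<Prod>i\<in>UNIV. d i)"
  by (subst det_diagonal) (simp_all add: diag_def)

lemma unitary_diag_cis: "unitary (diag (\<lambda>i. cis (\<theta> i)))"
proof -
  have "conj_transpose (diag (\<lambda>i. cis (\<theta> i))) = diag (\<lambda>i. cis (- \<theta> i))"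
    by (simp add: diag_def vec_eq_iff cis_cnj)
  then show ?thesis
    by (simp add: unitary_def diag_diag cis_mult) (simp add: diag_def mat_def vec_eq_iff)
qed

lemma prod_cis: "finite I \<Longrightarrow> (\<Prod>i\<in>I. cis (\<theta> i)) = cis (\<Sum>i\<in>I. \<theta> i)"
  by (induction I rule: finite_induct) (simp_all add: cis_mult)

text \<open>Test matrices with z and \<open>- cnj z\<close> at two mirrored off-diagonal places lie
  in \<open>su\<close>; z = 1 gives equality of the real parts, z = \<i> opposite imaginary
  parts.\<close>

lemma off_diagonal_eq_cnj:
  assumes "\<And>A. A \<in> su \<Longrightarrow> Re (trace (M ** A)) = 0" "i \<noteq> j"
  shows "M $ i $ j = cnj (M $ j $ i)"
proof -
  define A where "A z w = (\<chi> b a. (if a = j then if b = i then z else 0 else 0) +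
      (if a = i then if b = j then w else 0 else 0))" for z w :: complex
  have tr: "trace (M ** A z w) = z * M $ j $ i + w * M $ i $ j" for z w
  proof -
    have "trace (M ** A z w) = (\<Sum>a\<in>UNIV. (\<Sum>b\<in>UNIV. if a = j then if b = i then z * M $ a $ b else 0 else 0) +
        (\<Sum>b\<in>UNIV. if a = i then if b = j then w * M $ a $ b else 0 else 0))"
      unfolding trace_def mat_mult_nth A_def sum.distrib[symmetric]
      by (intro sum.cong refl) (auto simp: algebra_simps)
    also have "\<dots> = (\<Sum>a\<in>UNIV. (if a = j then z * M $ a $ i else 0) + (if a = i then w * M $ a $ j else 0))"
      by (intro sum.cong refl arg_cong2[of _ _ _ _ "(+)"]) auto
    finally show ?thesis by (simp add: sum.distrib)
  qed
  have su: "A z (- cnj z) \<in> su" for z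
    using assms(2) unfolding su_def
    by (auto simp: A_def vec_eq_iff trace_def intro!: sum.neutral)
  from assms(1)[OF su[of 1]] assms(1)[OF su[of \<i>]] show ?thesis
    by (simp add: tr complex_eq_iff)
qed

context generators
begin

text \<open>The ball around s is moved to the identity by the inverse of s, which is available in
  \<open>C\<close>.\<close>

lemma C_contains_ball:
  obtains \<eta> where "\<eta> > 0" "\<And>Q. special_unitary Q \<Longrightarrow> dist Q (mat 1) < \<eta> \<Longrightarrow> Q \<in> C"
proof -
  obtain s \<delta> where s: "s \<in> reach G" and \<delta>: "\<delta> > 0" and
    ball: "\<And>\<Gamma>. special_unitary \<Gamma> \<Longrightarrow> dist \<Gamma> s < \<delta> \<Longrightarrow> \<Gamma> \<in> reach G"
    using reach_contains_ball by blast
  have sC: "s \<in> C" using s reach_subset_C by auto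
  have "continuous (at (mat 1)) (\<lambda>Q. s ** Q)"
    by (intro linear_continuous_at mm.bounded_linear_right)
  then obtain \<eta> where \<eta>: "\<eta> > 0" "\<And>Q. dist Q (mat 1) < \<eta> \<Longrightarrow> dist (s ** Q) (s ** mat 1) < \<delta>"
    using \<delta> unfolding continuous_at_eps_delta by blast
  have "Q \<in> C" if Q: "special_unitary Q" "dist Q (mat 1) < \<eta>" for Q
  proof -
    have "s ** Q \<in> reach G"
      using \<eta>(2)[OF Q(2)] special_unitary_mult[OF special_unitary_reach[OF s] Q(1)]
      by (intro ball) simp_all
    then have "conj_transpose s ** (s ** Q) \<in> C"
      using reach_subset_C by (intro C_mult[OF conj_transpose_C[OF sC]]) blast
    then show ?thesis by (simp add: unitary_cancel_left unitary_C[OF sC])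
  qed
  then show thesis using that[OF \<eta>(1)] by blast
qed

text \<open>Dividing the phases by a large integer gives a root close to the identity. If the root
  is again special unitary it lies in the ball inside \<open>C\<close>, and so does its power in
  \<open>C\<close>.\<close>

lemma diagonal_C:
  assumes su: "special_unitary \<Gamma>" and diagonal: "\<And>i j. i \<noteq> j \<Longrightarrow> \<Gamma> $ i $ j = 0"
  shows "\<Gamma> \<in> C"
proof -
  have G: "\<Gamma> = diag (\<lambda>i. \<Gamma> $ i $ i)"
    using diagonal by (simp add: diag_def vec_eq_iff)
  have n1: "norm (\<Gamma> $ i $ i) = 1" for i
  proof -
    have "(conj_transpose \<Gamma> ** \<Gamma>) $ i $ i = mat 1 $ i $ i"
      using su by (simp add: special_unitary_def unitary_def)
    moreover have "(conj_transpose \<Gamma> ** \<Gamma>) $ i $ i =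
        (\<Sum>k\<in>UNIV. if k = i then cnj (\<Gamma> $ i $ i) * \<Gamma> $ i $ i else 0)"
      unfolding mat_mult_nth using diagonal by (intro sum.cong) auto
    ultimately have "cnj (\<Gamma> $ i $ i) * \<Gamma> $ i $ i = 1"
      by (simp add: mat_nth)
    then have "(norm (\<Gamma> $ i $ i))\<^sup>2 = 1"
      by (metis complex_norm_square mult.commute of_real_eq_1_iff)
    then show ?thesis by (simp add: power2_eq_1_iff) (metis norm_ge_zero neg_0_le_iff_le not_one_le_zero)
  qed
  define \<theta> where "\<theta> i = Arg (\<Gamma> $ i $ i)" for i
  have cis: "cis (\<theta> i) = \<Gamma> $ i $ i" for i
  proof -
    have "\<Gamma> $ i $ i \<noteq> 0" using n1[of i] by auto
    then show ?thesis
      using n1[of i] cis_Arg[of "\<Gamma> $ i $ i"] by (simp add: \<theta>_def sgn_div_norm)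
  qed
  have "cis (\<Sum>i\<in>UNIV. \<theta> i) = det \<Gamma>"
    by (subst G) (simp add: det_diag cis flip: prod_cis)
  then have sum: "cis (\<Sum>i\<in>UNIV. \<theta> i) = 1" using su by (simp add: special_unitary_def)
  fix i0
  \<comment> \<open>The arguments sum only to a multiple of 2 pi. Moving that multiple into one
    phase makes the sum zero, so that dividing the phases preserves determinant one.\<close>
  define \<phi> where "\<phi> = \<theta>(i0 := \<theta> i0 - (\<Sum>i\<in>UNIV. \<theta> i))"
  have cis': "cis (\<phi> i) = \<Gamma> $ i $ i" for i
    using cis sum by (simp add: \<phi>_def flip: cis_divide)
  have "(\<Sum>i\<in>UNIV. \<phi> i) = \<phi> i0 + (\<Sum>i\<in>UNIV - {i0}. \<theta> i)"
    by (subst sum.remove[of _ i0]) (auto simp: \<phi>_def intro!: sum.cong)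
  also have "\<dots> = 0"
    using sum.remove[of UNIV i0 \<theta>] by (simp add: \<phi>_def)
  finally have sum0: "(\<Sum>i\<in>UNIV. \<phi> i) = 0" .
  obtain \<eta> where \<eta>: "\<eta> > 0" "\<And>Q. special_unitary Q \<Longrightarrow> dist Q (mat 1) < \<eta> \<Longrightarrow> Q \<in> C"
    using C_contains_ball by blast
  define q where "q n = diag (\<lambda>i. cis (\<phi> i / real (Suc n)))" for n
  have q_su: "special_unitary (q n)" for n
    using sum0 unfolding special_unitary_def q_def det_diag prod_cis[OF finite]
    by (simp add: unitary_diag_cis flip: sum_divide_distrib)
  have "q \<longlonglongrightarrow> mat 1"
  proof (intro vec_tendstoI)
    fix i j
    have "(\<lambda>n. \<phi> i / real (Suc n)) \<longlonglongrightarrow> 0"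
      using LIMSEQ_Suc[OF lim_const_over_n[of "\<phi> i"]] by simp
    then have "(\<lambda>n. exp (\<i> * of_real (\<phi> i / real (Suc n)))) \<longlonglongrightarrow> exp (\<i> * of_real 0)"
      by (intro tendsto_intros)
    then have "(\<lambda>n. cis (\<phi> i / real (Suc n))) \<longlonglongrightarrow> 1"
      unfolding cis_conv_exp by simp
    then show "(\<lambda>n. q n $ i $ j) \<longlonglongrightarrow> mat 1 $ i $ j"
      by (cases "i = j") (simp_all add: q_def diag_def mat_nth del: of_nat_Suc)
  qed
  then obtain n where "dist (q n) (mat 1) < \<eta>"
    using \<eta>(1) by (metis LIMSEQ_iff_nz dist_norm lim_sequentially order_refl)
  then have "mpow (q n) (Suc n) \<in> C"
    using \<eta>(2) q_su mpow_C by blast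
  moreover have "cis (\<phi> i / real (Suc n)) ^ Suc n = \<Gamma> $ i $ i" for i
    by (simp only: Complex.DeMoivre) (simp add: cis' del: of_nat_Suc)
  then have "mpow (q n) (Suc n) = \<Gamma>"
    unfolding q_def mpow_diag by (simp only: G[symmetric])
  ultimately show ?thesis by simp
qed

text \<open>Along each curve through the identity in \<open>C\<close> the functional has a maximum
  at time 0, so it vanishes on the orbit and, by linearity, on its span, which contains
  \<open>su\<close>.\<close>

lemma stationary_su:
  assumes "\<And>g. g \<in> C \<Longrightarrow> Re (trace (M ** g)) \<le> Re (trace M)" and "X \<in> su"
  shows "Re (trace (M ** X)) = 0"
proof -
  have lin: "linear (\<lambda>X. Re (trace (M ** X)))"
    by (simp add: linear_iff mm.add_right mm.scaleR_right trace_add trace_scaleR)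
  then have bl: "bounded_linear (\<lambda>X. Re (trace (M ** X)))"
    by (simp add: linear_conv_bounded_linear)
  have "orbit \<subseteq> {X. Re (trace (M ** X)) = 0}"
  proof
    fix X assume "X \<in> orbit"
    then obtain \<gamma> where \<gamma>: "\<And>t. \<gamma> t \<in> C" "\<gamma> 0 = mat 1" "(\<gamma> has_vector_derivative X) (at 0)"
      using orbit_curve by blast
    have "((\<lambda>t. Re (trace (M ** \<gamma> t))) has_real_derivative Re (trace (M ** X))) (at 0)"
      using bounded_linear.has_vector_derivative[OF bl \<gamma>(3)]
      by (simp add: has_real_derivative_iff_has_vector_derivative)
    then have "Re (trace (M ** X)) = 0"
      using assms(1)[OF \<gamma>(1)] \<gamma>(2) by (intro DERIV_local_max[of _ _ 0 1]) auto
    then show "X \<in> {X. Re (trace (M ** X)) = 0}" by simp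
  qed
  moreover have "subspace {X. Re (trace (M ** X)) = 0}"
    using linear_subspace_kernel[OF lin] by simp
  ultimately have "span orbit \<subseteq> {X. Re (trace (M ** X)) = 0}"
    by (rule span_minimal)
  then show ?thesis using assms(2) su_subset_span_orbit by auto
qed

text \<open>Maximising the real part of the trace of \<open>D g \<Gamma> h\<close> over \<open>g\<close> and \<open>h\<close> in \<open>C\<close>, for a diagonal \<open>D\<close> with
  distinct positive entries, diagonalises \<open>\<Gamma>\<close>: stationarity in \<open>g\<close> and in \<open>h\<close> makes the off-diagonal
  entries vanish.\<close>

lemma special_unitary_C:
  assumes su: "special_unitary \<Gamma>" shows "\<Gamma> \<in> C"
proof -
  obtain f :: "'n \<Rightarrow> nat" where f: "inj f"
    using finite_imp_inj_to_nat_seg[of "UNIV :: 'n set"] by auto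
  define d where "d i = real (Suc (f i))" for i
  have d: "d i > 0" "i \<noteq> j \<Longrightarrow> d i \<noteq> d j" for i j
    using f by (auto simp: d_def dest: injD)
  define D where "D = diag (\<lambda>i. of_real (d i))"
  define v where "v p = Re (trace (D ** (fst p ** \<Gamma> ** snd p)))" for p
  have "continuous_on (C \<times> C) v"
    unfolding v_def
    by (intro continuous_on_Re linear_continuous_on_compose[OF _ linear_trace] mm.continuous_on continuous_intros)
  moreover have "compact (C \<times> C)" using compact_C by (intro compact_Times)
  moreover have "C \<times> C \<noteq> {}" using mat_1_C by auto
  ultimately obtain p where p: "p \<in> C \<times> C" "\<And>q. q \<in> C \<times> C \<Longrightarrow> v q \<le> v p"
    using continuous_attains_sup by meson
  obtain g h where gh: "p = (g, h)" by force
  have C: "g \<in> C" "h \<in> C" using p gh by auto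
  define B where "B = g ** \<Gamma> ** h"
  \<comment> \<open>By cyclicity of the trace, varying g on the left is a variation of the
    functional given by \<open>B ** D\<close>; varying h gives \<open>D ** B\<close> in the same
    way.\<close>
  have st1: "Re (trace ((B ** D) ** X)) = 0" if "X \<in> su" for X
  proof (rule stationary_su[OF _ that])
    fix x assume x: "x \<in> C"
    have "v (x ** g, h) \<le> v p" using x C by (intro p) (auto intro: C_mult)
    then show "Re (trace (B ** D ** x)) \<le> Re (trace (B ** D))"
      using trace_mult_commute[of D "x ** B"] trace_mult_commute[of "B" "D ** x"] trace_mult_commute[of B D]
      by (simp add: v_def gh B_def matrix_mul_assoc)
  qed
  have st2: "Re (trace ((D ** B) ** X)) = 0" if "X \<in> su" for X
  proof (rule stationary_su[OF _ that])
    fix x assume x: "x \<in> C"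
    have "v (g, h ** x) \<le> v p" using x C by (intro p) (auto intro: C_mult)
    then show "Re (trace (D ** B ** x)) \<le> Re (trace (D ** B))"
      by (simp add: v_def gh B_def matrix_mul_assoc)
  qed
  have "B $ j $ i = 0" if ij: "j \<noteq> i" for i j
  proof -
    have 1: "B $ i $ j * of_real (d j) = cnj (B $ j $ i) * of_real (d i)"
      using off_diagonal_eq_cnj[OF st1, of i j] ij by (simp add: D_def)
    have 2: "of_real (d i) * B $ i $ j = of_real (d j) * cnj (B $ j $ i)"
      using off_diagonal_eq_cnj[OF st2, of i j] ij by (simp add: D_def)
    \<comment> \<open>Eliminating the entry at (i, j) from the two relations leaves the difference
      of the squared weights times the entry at (j, i); the weights are positive and
      distinct.\<close>
    have "of_real (d i * d i) * cnj (B $ j $ i) = of_real (d i) * (B $ i $ j * of_real (d j))"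
      by (simp add: 1)
    also have "\<dots> = of_real (d j) * (of_real (d i) * B $ i $ j)" by simp
    also have "\<dots> = of_real (d j * d j) * cnj (B $ j $ i)" by (simp only: 2) simp
    finally have "B $ j $ i = 0 \<or> d i * d i = d j * d j"
      by (metis complex_cnj_zero_iff mult_right_cancel of_real_eq_iff)
    then show ?thesis
      using d[of i] d[of j] ij square_eq_iff[of "d i" "d j"] d(2)[of i j] by auto
  qed
  moreover have sC: "special_unitary x" if "x \<in> C" for x
  proof -
    have "reach G \<subseteq> {A. det A = 1}" using special_unitary_reach by (auto simp: special_unitary_def)
    moreover have "closed {A :: complex^'n^'n. det A = 1}"
      unfolding det_def by (intro closed_Collect_eq continuous_intros)
    ultimately have "C \<subseteq> {A. det A = 1}" unfolding C_def by (rule closure_minimal)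
    then show ?thesis using that unitary_C by (auto simp: special_unitary_def)
  qed
  then have "special_unitary B"
    using C su by (auto simp: B_def intro!: special_unitary_mult)
  ultimately have "B \<in> C" by (intro diagonal_C)
  then have "conj_transpose g ** B ** conj_transpose h \<in> C"
    using C by (intro C_mult conj_transpose_C)
  moreover have "conj_transpose g ** B ** conj_transpose h = \<Gamma>"
    using unitary_C[OF C(1)] unitary_C[OF C(2)]
    by (simp add: B_def matrix_mul_assoc[symmetric] unitary_cancel_left) (simp add: unitary_def)
  ultimately show ?thesis by simp
qed

text \<open>Choose x in the semigroup close to \<open>\<Gamma> ** conj_transpose s\<close>. Then the
  inverse of x times \<Gamma> is close to s, hence reachable, and \<Gamma> is a product of two
  reachable matrices: no inverse is used as a motion.\<close>

theorem special_unitary_subset_reach: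
  assumes su: "special_unitary \<Gamma>" shows "\<Gamma> \<in> reach G"
proof -
  obtain s \<delta> where s: "s \<in> reach G" and \<delta>: "\<delta> > 0" and
    ball: "\<And>\<Gamma>. special_unitary \<Gamma> \<Longrightarrow> dist \<Gamma> s < \<delta> \<Longrightarrow> \<Gamma> \<in> reach G"
    using reach_contains_ball by blast
  let ?T = "\<Gamma> ** conj_transpose s"
  have "?T \<in> closure (reach G)"
    using special_unitary_C[of ?T] su special_unitary_reach[OF s]
    by (simp add: C_def special_unitary_mult special_unitary_conj_transpose)
  then obtain x where x: "\<And>n. x n \<in> reach G" "x \<longlonglongrightarrow> ?T"
    by (auto simp: closure_sequential)
  have "(\<lambda>n. conj_transpose (x n) ** \<Gamma>) \<longlonglongrightarrow> conj_transpose ?T ** \<Gamma>"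
    by (intro mm.tendsto bounded_linear.tendsto[OF bounded_linear_conj_transpose] x tendsto_const)
  also have "conj_transpose ?T ** \<Gamma> = s"
    using su by (simp add: conj_transpose_mult matrix_mul_assoc[symmetric]) (simp add: special_unitary_def unitary_def)
  finally obtain n where n: "dist (conj_transpose (x n) ** \<Gamma>) s < \<delta>"
    using \<delta> unfolding lim_sequentially by blast
  have sx: "special_unitary (x n)" by (rule special_unitary_reach[OF x(1)])
  have "conj_transpose (x n) ** \<Gamma> \<in> reach G"
    using n su sx by (intro ball special_unitary_mult special_unitary_conj_transpose)
  then have "x n ** (conj_transpose (x n) ** \<Gamma>) \<in> reach G"
    by (rule reach_mult[OF x(1)])
  then show ?thesis
    using sx by (simp add: unitary_cancel_left' special_unitary_def)
qed

end

section \<open>Pauli strings\<close>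

lemma tensor_op_nth: "tensor_op A $ r $ s = (\<Prod>j\<in>UNIV. A j $ r j $ s j)"
  by (simp add: tensor_op_def)

text \<open>Sums over the product basis factor site by site; products, traces and the completeness
  relation of tensor operators reduce to a single qubit through this identity.\<close>

lemma prod_sum_fun:
  fixes f :: "'n::finite \<Rightarrow> 'b::finite \<Rightarrow> complex"
  shows "(\<Prod>j\<in>UNIV. \<Sum>a\<in>UNIV. f j a) = (\<Sum>g\<in>UNIV. \<Prod>j\<in>UNIV. f j (g j))"
  using prod_sum_PiE[of "UNIV :: 'n set" "\<lambda>_. UNIV :: 'b set" f] by (simp add: PiE_UNIV_domain)

lemma tensor_op_mult: "tensor_op A ** tensor_op B = tensor_op (\<lambda>j. A j ** B j)"
  by (simp add: vec_eq_iff mat_mult_nth tensor_op_nth prod_sum_fun prod.distrib)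

lemma tensor_op_mat: "tensor_op (\<lambda>j. mat (c j) ** A j) = mat (\<Prod>j\<in>UNIV. c j) ** tensor_op A"
  by (simp add: vec_eq_iff tensor_op_nth prod.distrib)

lemma conj_transpose_tensor_op: "conj_transpose (tensor_op A) = tensor_op (\<lambda>j. conj_transpose (A j))"
  by (simp add: vec_eq_iff tensor_op_nth)

lemma trace_tensor_op: "trace (tensor_op A) = (\<Prod>j\<in>UNIV. trace (A j))"
  by (simp add: trace_def tensor_op_nth prod_sum_fun)

lemma tensor_op_mat_1: "tensor_op (\<lambda>j::'n. mat 1) = (mat 1 :: 'n::finite qubit_operator)"
proof -
  have "(\<Prod>j\<in>UNIV. mat 1 $ r j $ s j) = (mat 1 :: 'n qubit_operator) $ r $ s" for r s :: "'n \<Rightarrow> 2"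
  proof (cases "r = s")
    case False
    then obtain j where "r j \<noteq> s j" by auto
    then show ?thesis using False by (auto simp: mat_nth)
  qed (simp add: mat_nth)
  then show ?thesis by (simp add: vec_eq_iff tensor_op_nth)
qed

datatype pauli = PI | PX | PY | PZ

lemma UNIV_pauli: "UNIV = {PI, PX, PY, PZ}"
  by (auto intro: pauli.exhaust)

instance pauli :: finite
  by standard (simp add: UNIV_pauli)

fun pauli_mat :: "pauli \<Rightarrow> complex^2^2" where
  "pauli_mat PI = mat 1"
| "pauli_mat PX = pauli_X"
| "pauli_mat PY = pauli_Y"
| "pauli_mat PZ = pauli_Z"

text \<open>The product in the Klein four-group, that is, the product of Pauli matrices up to a phase.\<close>

fun pauli_mult :: "pauli \<Rightarrow> pauli \<Rightarrow> pauli" where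
  "pauli_mult PI q = q"
| "pauli_mult p PI = p"
| "pauli_mult PX PY = PZ"
| "pauli_mult PX PZ = PY"
| "pauli_mult PY PX = PZ"
| "pauli_mult PY PZ = PX"
| "pauli_mult PZ PX = PY"
| "pauli_mult PZ PY = PX"
| "pauli_mult PX PX = PI"
| "pauli_mult PY PY = PI"
| "pauli_mult PZ PZ = PI"

lemma pauli_mult_PI [simp]: "pauli_mult p PI = p"
  by (cases p) simp_all

lemma pauli_mult_third:
  assumes "p \<noteq> PI" "q \<noteq> PI" "p \<noteq> q"
  shows "pauli_mult p q \<noteq> PI" "p \<noteq> pauli_mult p q" "pauli_mult p (pauli_mult p q) = q"
  using assms by (cases p; cases q; simp)+

lemmas mat2_simps = vec_eq_iff forall_2 mat_mult_nth sum_2 mat_nth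
  pauli_X_def pauli_Y_def pauli_Z_def

lemma pauli_mat_mult_commuting:
  assumes "p = PI \<or> q = PI \<or> p = q"
  shows "pauli_mat p ** pauli_mat q = pauli_mat (pauli_mult p q)"
proof -
  have "pauli_X ** pauli_X = mat 1" "pauli_Y ** pauli_Y = mat 1" "pauli_Z ** pauli_Z = mat 1"
    by (simp_all add: mat2_simps)
  then show ?thesis using assms by (cases p; cases q) auto
qed

lemma pauli_mult_commute: "pauli_mult p q = pauli_mult q p"
  by (cases p; cases q) simp_all

text \<open>The sign e tells whether the pair follows the cyclic order X, Y, Z. The equation
  \<open>e * e = 1\<close> is the form in which the sign is later divided out.\<close>

lemma pauli_mat_mult_anticommuting:
  assumes "p \<noteq> PI" "q \<noteq> PI" "p \<noteq> q"
  shows "\<exists>e::real. e * e = 1 \<and> pauli_mat p ** pauli_mat q = mat (\<i> * of_real e) ** pauli_mat (pauli_mult p q) \<and>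
    pauli_mat q ** pauli_mat p = mat (- \<i> * of_real e) ** pauli_mat (pauli_mult p q)"
proof -
  have XY: "pauli_X ** pauli_Y = mat \<i> ** pauli_Z" "pauli_Y ** pauli_X = mat (- \<i>) ** pauli_Z"
    and YZ: "pauli_Y ** pauli_Z = mat \<i> ** pauli_X" "pauli_Z ** pauli_Y = mat (- \<i>) ** pauli_X"
    and ZX: "pauli_Z ** pauli_X = mat \<i> ** pauli_Y" "pauli_X ** pauli_Z = mat (- \<i>) ** pauli_Y"
    by (simp_all add: mat2_simps)
  have "(p, q) \<in> {(PX, PY), (PY, PZ), (PZ, PX)} \<or> (q, p) \<in> {(PX, PY), (PY, PZ), (PZ, PX)}"
    using assms by (cases p; cases q) auto
  then show ?thesis
  proof
    assume "(p, q) \<in> {(PX, PY), (PY, PZ), (PZ, PX)}"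
    then show ?thesis using XY YZ ZX by (intro exI[of _ 1]) auto
  next
    assume "(q, p) \<in> {(PX, PY), (PY, PZ), (PZ, PX)}"
    then show ?thesis using XY YZ ZX by (intro exI[of _ "-1"]) auto
  qed
qed

lemma conj_transpose_pauli_mat [simp]: "conj_transpose (pauli_mat p) = pauli_mat p"
  by (cases p) (simp_all add: mat2_simps)

lemma trace_pauli_mat: "p \<noteq> PI \<Longrightarrow> trace (pauli_mat p) = 0"
  by (cases p) (simp_all add: trace_def mat2_simps)

text \<open>Divided by the square root of 2, the four matrices are an orthonormal basis. This is its
  completeness relation, in an entrywise form that multiplies over the sites.\<close>

lemma pauli_mat_complete:
  "(\<Sum>p\<in>UNIV. pauli_mat p $ a $ b * cnj (pauli_mat p $ a' $ b')) = (if a = a' \<and> b = b' then 2 else 0)"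
proof -
  have "\<forall>a b a' b'. (\<Sum>p\<in>UNIV. pauli_mat p $ a $ b * cnj (pauli_mat p $ a' $ b')) =
      (if a = a' \<and> b = b' then 2 else 0)"
    by (simp add: UNIV_pauli mat2_simps)
  then show ?thesis by blast
qed

definition pauli_string :: "('n::finite \<Rightarrow> pauli) \<Rightarrow> 'n qubit_operator" where
  "pauli_string \<sigma> = tensor_op (\<lambda>j. pauli_mat (\<sigma> j))"

lemma pauli_string_PI: "pauli_string (\<lambda>_. PI) = mat 1"
  by (simp add: pauli_string_def tensor_op_mat_1)

lemma conj_transpose_pauli_string [simp]: "conj_transpose (pauli_string \<sigma>) = pauli_string \<sigma>"
  by (simp add: pauli_string_def conj_transpose_tensor_op)

lemma trace_pauli_string:
  assumes "\<sigma> \<noteq> (\<lambda>_. PI)" shows "trace (pauli_string \<sigma>) = 0"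
proof -
  obtain j where "trace (pauli_mat (\<sigma> j)) = 0" using assms trace_pauli_mat by blast
  then show ?thesis by (auto simp: pauli_string_def trace_tensor_op)
qed

lemma pauli_string_su:
  assumes "\<sigma> \<noteq> (\<lambda>_. PI)" shows "mat \<i> ** pauli_string \<sigma> \<in> su"
proof -
  have "conj_transpose (mat \<i> ** pauli_string \<sigma>) = - (mat \<i> ** pauli_string \<sigma>)"
    by (simp add: conj_transpose_mult vec_eq_iff)
  then show ?thesis
    using trace_pauli_string[OF assms] by (simp add: su_def trace_mat_mult)
qed

lemma acting_on_pauli: "acting_on (pauli_mat p) k = pauli_string ((\<lambda>_. PI)(k := p))"
  unfolding acting_on_def pauli_string_def by (rule arg_cong[of _ _ tensor_op]) auto

lemma acting_on_mult_pauli: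
  assumes "c \<noteq> t"
  shows "acting_on (pauli_mat p) c ** acting_on (pauli_mat q) t = pauli_string ((\<lambda>_. PI)(c := p, t := q))"
  unfolding acting_on_def pauli_string_def tensor_op_mult using assms
  by (intro arg_cong[of _ _ tensor_op]) auto

lemma pauli_string_complete:
  "(\<Sum>\<sigma>\<in>UNIV. pauli_string \<sigma> $ r $ s * cnj (pauli_string \<sigma> $ r' $ s')) =
    (if r = r' \<and> s = s' then 2 ^ CARD('n) else 0)" for r s r' s' :: "'n::finite \<Rightarrow> 2"
proof -
  have "(\<Sum>\<sigma>\<in>UNIV. pauli_string \<sigma> $ r $ s * cnj (pauli_string \<sigma> $ r' $ s')) =
      (\<Prod>j\<in>UNIV. if r j = r' j \<and> s j = s' j then 2 else 0)"
    unfolding pauli_mat_complete[symmetric] prod_sum_fun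
    by (simp add: pauli_string_def tensor_op_nth prod.distrib)
  also have "\<dots> = (if r = r' \<and> s = s' then 2 ^ CARD('n) else 0)"
    by (auto simp: fun_eq_iff)
  finally show ?thesis .
qed

text \<open>Strings are self-adjoint, so the traces are inner products with them; the factor
  \<open>2 ^ CARD('n)\<close> is the squared norm of a string.\<close>

lemma pauli_string_expansion:
  fixes A :: "'n::finite qubit_operator"
  shows "mat (2 ^ CARD('n)) ** A = (\<Sum>\<sigma>\<in>UNIV. mat (trace (pauli_string \<sigma> ** A)) ** pauli_string \<sigma>)"
proof -
  have "(\<Sum>\<sigma>\<in>UNIV. mat (trace (pauli_string \<sigma> ** A)) ** pauli_string \<sigma>) $ r $ s = 2 ^ CARD('n) * A $ r $ s"
    for r s
  proof -
    have tr: "trace (pauli_string \<sigma> ** A) = (\<Sum>s'\<in>UNIV. \<Sum>r'\<in>UNIV. cnj (pauli_string \<sigma> $ r' $ s') * A $ r' $ s')" for \<sigma>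
      unfolding trace_def mat_mult_nth
      by (intro sum.cong refl) (metis conj_transpose_nth conj_transpose_pauli_string)
    have "(\<Sum>\<sigma>\<in>UNIV. mat (trace (pauli_string \<sigma> ** A)) ** pauli_string \<sigma>) $ r $ s =
        (\<Sum>\<sigma>\<in>UNIV. \<Sum>s'\<in>UNIV. \<Sum>r'\<in>UNIV. pauli_string \<sigma> $ r $ s * cnj (pauli_string \<sigma> $ r' $ s') * A $ r' $ s')"
      by (simp add: sum_component tr sum_distrib_left sum_distrib_right mult_ac)
    also have "\<dots> = (\<Sum>s'\<in>UNIV. \<Sum>r'\<in>UNIV. \<Sum>\<sigma>\<in>UNIV. pauli_string \<sigma> $ r $ s * cnj (pauli_string \<sigma> $ r' $ s') * A $ r' $ s')"
      by (subst sum.swap, rule sum.cong[OF refl], rule sum.swap)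
    also have "\<dots> = (\<Sum>s'\<in>UNIV. \<Sum>r'\<in>UNIV. if r' = r then if s' = s then 2 ^ CARD('n) * A $ r' $ s' else 0 else 0)"
      unfolding sum_distrib_right[symmetric] pauli_string_complete by (intro sum.cong refl) auto
    finally show ?thesis by simp
  qed
  then show ?thesis by (simp add: vec_eq_iff)
qed

text \<open>For a skew-adjoint matrix the coefficients are imaginary, and zero trace removes the
  identity string; what remains is a real combination of the given elements.\<close>

lemma su_subset_of_pauli_strings:
  assumes V: "subspace V" and mem: "\<And>\<sigma>. \<sigma> \<noteq> (\<lambda>_. PI) \<Longrightarrow> mat \<i> ** pauli_string \<sigma> \<in> V"
  shows "(su :: 'n::finite qubit_operator set) \<subseteq> V"
proof
  fix A :: "'n qubit_operator" assume A: "A \<in> su"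
  define y where "y \<sigma> = Im (trace (pauli_string \<sigma> ** A))" for \<sigma>
  have c: "trace (pauli_string \<sigma> ** A) = \<i> * of_real (y \<sigma>)" for \<sigma>
  proof -
    have "cnj (trace (pauli_string \<sigma> ** A)) = trace (conj_transpose A ** pauli_string \<sigma>)"
      by (simp add: conj_transpose_mult flip: trace_conj_transpose)
    also have "\<dots> = - trace (pauli_string \<sigma> ** A)"
      using A trace_mult_commute[of A "pauli_string \<sigma>"]
      by (simp add: su_def mm.minus_left linear_neg[OF linear_trace])
    finally show ?thesis by (simp add: y_def complex_eq_iff)
  qed
  have "y (\<lambda>_. PI) = 0" using A by (simp add: y_def pauli_string_PI su_def)
  then have "y \<sigma> *\<^sub>R (mat \<i> ** pauli_string \<sigma>) \<in> V" for \<sigma>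
    using mem[of \<sigma>] V by (cases "\<sigma> = (\<lambda>_. PI)") (auto intro: subspace_scale simp: subspace_0)
  then have "(\<Sum>\<sigma>\<in>UNIV. y \<sigma> *\<^sub>R (mat \<i> ** pauli_string \<sigma>)) \<in> V"
    by (intro subspace_sum[OF V])
  also have "(\<Sum>\<sigma>\<in>UNIV. y \<sigma> *\<^sub>R (mat \<i> ** pauli_string \<sigma>)) = mat (2 ^ CARD('n)) ** A"
    unfolding pauli_string_expansion c scaleR_eq_mat
    by (simp add: matrix_mul_assoc mat_mat mult.commute)
  also have "\<dots> = (2 ^ CARD('n)) *\<^sub>R A" by (simp add: scaleR_eq_mat)
  finally have "(1 / 2 ^ CARD('n)) *\<^sub>R ((2 ^ CARD('n)) *\<^sub>R A) \<in> V"
    by (rule subspace_scale[OF V])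
  then show "A \<in> V" by simp
qed

text \<open>The factors anticommute at the single site u and commute elsewhere, so the strings
  anticommute and their product is a string up to a phase.\<close>

lemma pauli_string_mult:
  fixes \<sigma> \<tau> :: "'n::finite \<Rightarrow> pauli"
  assumes u: "\<sigma> u \<noteq> PI" "\<tau> u \<noteq> PI" "\<sigma> u \<noteq> \<tau> u"
    and other: "\<And>j. j \<noteq> u \<Longrightarrow> \<sigma> j = PI \<or> \<tau> j = PI \<or> \<sigma> j = \<tau> j"
  defines "\<rho> \<equiv> \<lambda>j. pauli_mult (\<sigma> j) (\<tau> j)"
  shows "\<exists>e::real. e * e = 1 \<and> pauli_string \<sigma> ** pauli_string \<tau> = mat (\<i> * of_real e) ** pauli_string \<rho> \<and>
    pauli_string \<tau> ** pauli_string \<sigma> = mat (- \<i> * of_real e) ** pauli_string \<rho>"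
proof -
  obtain e :: real where e: "e * e = 1"
      "pauli_mat (\<sigma> u) ** pauli_mat (\<tau> u) = mat (\<i> * of_real e) ** pauli_mat (\<rho> u)"
      "pauli_mat (\<tau> u) ** pauli_mat (\<sigma> u) = mat (- \<i> * of_real e) ** pauli_mat (\<rho> u)"
    using pauli_mat_mult_anticommuting[OF u] unfolding \<rho>_def by blast
  have "(\<lambda>j. pauli_mat (\<sigma> j) ** pauli_mat (\<tau> j)) = (\<lambda>j. mat (if j = u then \<i> * of_real e else 1) ** pauli_mat (\<rho> j))"
    using e(2) pauli_mat_mult_commuting other by (force simp: \<rho>_def)
  then have 1: "pauli_string \<sigma> ** pauli_string \<tau> = mat (\<i> * of_real e) ** pauli_string \<rho>"
    by (simp add: pauli_string_def tensor_op_mult tensor_op_mat)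
  have "(\<lambda>j. pauli_mat (\<tau> j) ** pauli_mat (\<sigma> j)) = (\<lambda>j. mat (if j = u then - \<i> * of_real e else 1) ** pauli_mat (\<rho> j))"
  proof
    fix j
    show "pauli_mat (\<tau> j) ** pauli_mat (\<sigma> j) = mat (if j = u then - \<i> * of_real e else 1) ** pauli_mat (\<rho> j)"
      using e(3) pauli_mat_mult_commuting[of "\<tau> j" "\<sigma> j"] other[of j] pauli_mult_commute[of "\<tau> j" "\<sigma> j"]
      by (cases "j = u") (auto simp: \<rho>_def)
  qed
  then have "pauli_string \<tau> ** pauli_string \<sigma> = mat (- \<i> * of_real e) ** pauli_string \<rho>"
    by (simp add: pauli_string_def tensor_op_mult tensor_op_mat)
  with 1 e(1) show ?thesis by blast
qed

section \<open>Generating Pauli strings along a connected graph\<close>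

locale pauli_closed =
  fixes V :: "'n::finite qubit_operator set" and E :: "('n \<times> 'n) set"
  assumes V: "subspace V"
    and bracket: "\<And>A B. A \<in> V \<Longrightarrow> B \<in> V \<Longrightarrow> A ** B - B ** A \<in> V"
    and X: "\<And>k. mat \<i> ** acting_on pauli_X k \<in> V"
    and Y: "\<And>k. mat \<i> ** acting_on pauli_Y k \<in> V"
    and ZX: "\<And>c t. (c, t) \<in> E \<Longrightarrow> mat \<i> ** (acting_on pauli_Z c ** acting_on pauli_X t) \<in> V"
    and irrefl: "irrefl E"
    and connected: "\<And>u v. (u, v) \<in> (E \<union> E\<inverse>)\<^sup>*"
begin

definition generated :: "('n \<Rightarrow> pauli) \<Rightarrow> bool" where
  "generated \<sigma> \<longleftrightarrow> mat \<i> ** pauli_string \<sigma> \<in> V"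

text \<open>Grouping strings by support forgets the individual letters, so the combinatorics along
  the graph concerns vertex sets only.\<close>

definition all_generated :: "'n set \<Rightarrow> bool" where
  "all_generated A \<longleftrightarrow> (\<forall>\<sigma>. {j. \<sigma> j \<noteq> PI} = A \<longrightarrow> generated \<sigma>)"

abbreviation none :: "'n \<Rightarrow> pauli" where "none \<equiv> \<lambda>_. PI"

text \<open>For anticommuting strings both terms of the commutator add up, giving a nonzero real
  multiple of \<i> times the product string.\<close>

lemma generated_mult:
  assumes gen: "generated \<sigma>" "generated \<tau>"
    and u: "\<sigma> u \<noteq> PI" "\<tau> u \<noteq> PI" "\<sigma> u \<noteq> \<tau> u"
    and other: "\<And>j. j \<noteq> u \<Longrightarrow> \<sigma> j = PI \<or> \<tau> j = PI \<or> \<sigma> j = \<tau> j"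
    and \<rho>: "\<And>j. \<rho> j = pauli_mult (\<sigma> j) (\<tau> j)"
  shows "generated \<rho>"
proof -
  obtain e :: real where e: "e * e = 1"
    "pauli_string \<sigma> ** pauli_string \<tau> = mat (\<i> * of_real e) ** pauli_string \<rho>"
    "pauli_string \<tau> ** pauli_string \<sigma> = mat (- \<i> * of_real e) ** pauli_string \<rho>"
    using pauli_string_mult[of \<sigma> u \<tau>, OF u other] unfolding \<rho>[symmetric] by blast
  let ?P = "pauli_string \<sigma>" and ?Q = "pauli_string \<tau>"
  have "(mat \<i> ** ?P) ** (mat \<i> ** ?Q) - (mat \<i> ** ?Q) ** (mat \<i> ** ?P) \<in> V"
    using gen by (intro bracket) (simp_all add: generated_def)
  also have "(mat \<i> ** ?P) ** (mat \<i> ** ?Q) - (mat \<i> ** ?Q) ** (mat \<i> ** ?P) =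
      mat (\<i> * \<i>) ** (?P ** ?Q) - mat (\<i> * \<i>) ** (?Q ** ?P)"
    by (simp only: mat_mult_mat_mult)
  also have "\<dots> = (- 2 * e) *\<^sub>R (mat \<i> ** pauli_string \<rho>)"
    unfolding e(2,3) scaleR_eq_mat matrix_mul_assoc mat_mat
    by (simp add: vec_eq_iff algebra_simps)
  finally have "(- e / 2) *\<^sub>R ((- 2 * e) *\<^sub>R (mat \<i> ** pauli_string \<rho>)) \<in> V"
    by (rule subspace_scale[OF V])
  then show ?thesis using e(1) by (simp add: generated_def)
qed

lemma all_generated_single: "all_generated {u}"
proof -
  have X: "generated (none(u := PX))"
    using X[of u] acting_on_pauli[of PX u] by (simp add: generated_def)
  have Y: "generated (none(u := PY))"
    using Y[of u] acting_on_pauli[of PY u] by (simp add: generated_def)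
  have Z: "generated (none(u := PZ))"
    by (rule generated_mult[OF X Y, of u]) auto
  show ?thesis
    unfolding all_generated_def
  proof (intro allI impI)
    fix \<sigma> :: "'n \<Rightarrow> pauli" assume s: "{j. \<sigma> j \<noteq> PI} = {u}"
    then have "\<sigma> = none(u := \<sigma> u)" "\<sigma> u \<noteq> PI" by (auto simp: fun_eq_iff)
    then show "generated \<sigma>" using X Y Z by (metis pauli.exhaust)
  qed
qed

text \<open>A bracket with the third letter, placed on site u alone, turns the letter there into q
  and leaves all other sites untouched.\<close>

lemma generated_update:
  assumes "generated \<sigma>" "\<sigma> u \<noteq> PI" "q \<noteq> PI"
  shows "generated (\<sigma>(u := q))"
proof (cases "\<sigma> u = q")
  case False
  let ?r = "pauli_mult (\<sigma> u) q"
  note third = pauli_mult_third[OF assms(2,3) False]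
  have "{j. (none(u := ?r)) j \<noteq> PI} = {u}" using third by auto
  then have "generated (none(u := ?r))"
    using all_generated_single unfolding all_generated_def by blast
  with assms(1) show ?thesis
    by (rule generated_mult[of _ _ u]) (use assms third in auto)
qed (use assms in auto)

lemma all_generated_pair:
  assumes "(u, v) \<in> E" shows "all_generated {u, v}"
proof -
  have ne: "u \<noteq> v" using assms irrefl by (auto simp: irrefl_def)
  have base: "generated (none(u := PZ, v := PX))"
    using ZX[OF assms] acting_on_mult_pauli[OF ne, of PZ PX] by (simp add: generated_def)
  show ?thesis
    unfolding all_generated_def
  proof (intro allI impI)
    fix \<sigma> :: "'n \<Rightarrow> pauli" assume s: "{j. \<sigma> j \<noteq> PI} = {u, v}"
    then have "\<sigma> u \<noteq> PI" "\<sigma> v \<noteq> PI" by auto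
    then have "generated (none(u := PZ, v := PX, u := \<sigma> u, v := \<sigma> v))"
      using ne by (intro generated_update base) auto
    also have "none(u := PZ, v := PX, u := \<sigma> u, v := \<sigma> v) = \<sigma>"
      using s by (force simp: fun_eq_iff)
    finally show "generated \<sigma>" .
  qed
qed

lemma ex_other_pauli: "\<exists>p. p \<noteq> PI \<and> p \<noteq> q"
  by (cases q) auto

text \<open>A string on A and one on {u, v} overlap only at u. Their letters there, p and the
  product of p with the wanted letter, are distinct and nontrivial and multiply to the wanted
  letter, while v receives its letter from the second string.\<close>

lemma all_generated_insert:
  assumes "all_generated A" "all_generated {u, v}" "u \<in> A" "v \<notin> A"
  shows "all_generated (insert v A)"
  unfolding all_generated_def
proof (intro allI impI)
  fix \<tau> :: "'n \<Rightarrow> pauli" assume t: "{j. \<tau> j \<noteq> PI} = insert v A"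
  obtain p where p: "p \<noteq> PI" "p \<noteq> \<tau> u" using ex_other_pauli by blast
  have tu: "\<tau> u \<noteq> PI" "\<tau> v \<noteq> PI" using t assms by auto
  have ne: "u \<noteq> v" using assms by auto
  note third = pauli_mult_third[OF p(1) tu(1) p(2)]
  have "{j. (\<tau>(u := p, v := PI)) j \<noteq> PI} = A"
    using t assms(3,4) p by auto
  then have 1: "generated (\<tau>(u := p, v := PI))"
    using assms(1) unfolding all_generated_def by blast
  have "{j. (none(u := pauli_mult p (\<tau> u), v := \<tau> v)) j \<noteq> PI} = {u, v}"
    using third tu by auto
  then have 2: "generated (none(u := pauli_mult p (\<tau> u), v := \<tau> v))"
    using assms(2) unfolding all_generated_def by blast
  show "generated \<tau>"
    by (rule generated_mult[OF 1 2, of u]) (use third p ne in auto)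
qed

text \<open>Both strings carry the same letter at w, so it cancels there and does not disturb
  anticommutation, which comes from u alone.\<close>

lemma all_generated_remove:
  assumes "all_generated A" "all_generated {u, w}" "u \<in> A" "w \<in> A" "u \<noteq> w"
  shows "all_generated (A - {w})"
  unfolding all_generated_def
proof (intro allI impI)
  fix \<tau> :: "'n \<Rightarrow> pauli" assume t: "{j. \<tau> j \<noteq> PI} = A - {w}"
  obtain p where p: "p \<noteq> PI" "p \<noteq> \<tau> u" using ex_other_pauli by blast
  have tu: "\<tau> u \<noteq> PI" "\<tau> w = PI" using t assms by auto
  note third = pauli_mult_third[OF p(1) tu(1) p(2)]
  have "{j. (\<tau>(u := p, w := PZ)) j \<noteq> PI} = A"
    using t assms(3,4) p by auto
  then have 1: "generated (\<tau>(u := p, w := PZ))"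
    using assms(1) unfolding all_generated_def by blast
  have "{j. (none(u := pauli_mult p (\<tau> u), w := PZ)) j \<noteq> PI} = {u, w}"
    using third by auto
  then have 2: "generated (none(u := pauli_mult p (\<tau> u), w := PZ))"
    using assms(2) unfolding all_generated_def by blast
  show "generated \<tau>"
    by (rule generated_mult[OF 1 2, of u]) (use third p tu assms(5) in auto)
qed

text \<open>A walk is followed one edge at a time: the pairs {u, w} and {w, v} give the triple, from
  which the hinge w is removed again.\<close>

lemma all_generated_pairs:
  assumes "u \<noteq> v" shows "all_generated {u, v}"
proof -
  \<comment> \<open>The inequality is part of the induction claim since a walk may return to its
    start.\<close>
  have "u \<noteq> v \<longrightarrow> all_generated {u, v}"
    using connected[of u v]
  proof (induction rule: rtrancl_induct)
    case (step w v)
    have wv: "all_generated {w, v}" "w \<noteq> v"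
      using step(2) all_generated_pair[of w v] all_generated_pair[of v w] irrefl
      by (auto simp: insert_commute irrefl_def)
    show ?case
    proof
      assume uv: "u \<noteq> v"
      show "all_generated {u, v}"
      proof (cases "u = w")
        case False
        then have uw: "all_generated {u, w}" using step by simp
        have "all_generated (insert v {u, w})"
          using wv uv by (intro all_generated_insert[OF uw wv(1)]) auto
        then have "all_generated (insert v {u, w} - {w})"
          using False by (intro all_generated_remove[OF _ uw]) auto
        also have "insert v {u, w} - {w} = {u, v}" using False wv by auto
        finally show ?thesis .
      qed (use wv in simp)
    qed
  qed simp
  then show ?thesis using assms by blast
qed

text \<open>All pairs being available, a support grows by one vertex at a time whether or not the
  vertices are adjacent.\<close>

lemma all_generated_nonempty: "A \<noteq> {} \<Longrightarrow> all_generated A"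
  using finite[of A]
proof (induction A rule: finite_induct)
  case (insert v A)
  show ?case
  proof (cases "A = {}")
    case False
    then obtain u where "u \<in> A" by auto
    then show ?thesis
      using insert False by (intro all_generated_insert[of A u v] all_generated_pairs) auto
  qed (simp add: all_generated_single)
qed simp

theorem su_subset: "su \<subseteq> V"
proof (rule su_subset_of_pauli_strings[OF V])
  fix \<sigma> :: "'n \<Rightarrow> pauli" assume "\<sigma> \<noteq> none"
  then have "{j. \<sigma> j \<noteq> PI} \<noteq> {}" by auto
  then show "mat \<i> ** pauli_string \<sigma> \<in> V"
    using all_generated_nonempty unfolding all_generated_def generated_def by blast
qed

end

section \<open>Piecewise constant controls\<close>

abbreviation const_hamiltonian ::
  "'n::finite qubit_operator \<Rightarrow> ('n \<times> 'n) set \<Rightarrow> ('n \<Rightarrow> real) \<Rightarrow> ('n \<Rightarrow> real) \<Rightarrow> ('n \<Rightarrow> 'n \<Rightarrow> real) \<Rightarrow>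
    'n qubit_operator" where
  "const_hamiltonian H0 E x y w \<equiv> hamiltonian H0 E (\<lambda>k _. x k) (\<lambda>k _. y k) (\<lambda>c t _. w c t) 0"

definition directions :: "'n::finite qubit_operator \<Rightarrow> ('n \<times> 'n) set \<Rightarrow> real \<Rightarrow> 'n qubit_operator set" where
  "directions H0 E M = {mat (- \<i>) ** const_hamiltonian H0 E x y w | x y w.
     (\<forall>k. \<bar>x k\<bar> \<le> M \<and> \<bar>y k\<bar> \<le> M) \<and> (\<forall>c t. \<bar>w c t\<bar> \<le> M)}"

lemma direction_expand:
  "mat (- \<i>) ** const_hamiltonian H0 E x y w = mat (- \<i>) ** H0 +
     (\<Sum>k\<in>UNIV. x k *\<^sub>R (mat (- \<i>) ** acting_on pauli_X k) + y k *\<^sub>R (mat (- \<i>) ** acting_on pauli_Y k)) +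
     (\<Sum>e\<in>E. w (fst e) (snd e) *\<^sub>R (mat (- \<i>) ** (acting_on pauli_Z (fst e) ** acting_on pauli_X (snd e))))"
  by (simp add: hamiltonian_def mm.add_right mm.sum_right mm.scaleR_right case_prod_beta)

lemma mat_minus_imp: "mat (- \<i>) ** A = - (mat \<i> ** A)" for A :: "complex^'n^'m"
  by (simp add: vec_eq_iff)

lemma directions_subset_su:
  assumes H0: "self_adjoint H0" "trace H0 = 0" and E: "irrefl E"
  shows "directions H0 E M \<subseteq> su"
proof -
  have neg: "A \<in> su \<Longrightarrow> - A \<in> su" for A :: "'a qubit_operator"
    using subspace_neg[OF subspace_su] .
  have H: "mat (- \<i>) ** H0 \<in> su"
  proof -
    have "conj_transpose (mat (- \<i>) ** H0) = - (mat (- \<i>) ** H0)"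
      using H0(1) by (simp add: self_adjoint_def conj_transpose_mult mat_mult_commute[of H0] vec_eq_iff)
    then show ?thesis using H0(2) by (simp add: su_def trace_mat_mult)
  qed
  have X: "mat (- \<i>) ** acting_on pauli_X k \<in> su" for k :: 'a
    using pauli_string_su[of "(\<lambda>_. PI)(k := PX)"] acting_on_pauli[of PX k]
    by (auto simp: mat_minus_imp fun_eq_iff intro!: neg split: if_splits)
  have Y: "mat (- \<i>) ** acting_on pauli_Y k \<in> su" for k :: 'a
    using pauli_string_su[of "(\<lambda>_. PI)(k := PY)"] acting_on_pauli[of PY k]
    by (auto simp: mat_minus_imp fun_eq_iff intro!: neg split: if_splits)
  have ZX: "mat (- \<i>) ** (acting_on pauli_Z c ** acting_on pauli_X t) \<in> su" if "(c, t) \<in> E" for c t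
  proof -
    have "c \<noteq> t" using that E by (auto simp: irrefl_def)
    moreover have "(\<lambda>_. PI)(c := PZ, t := PX) \<noteq> (\<lambda>_. PI)" by (metis fun_upd_same pauli.distinct(1))
    ultimately show ?thesis
      using pauli_string_su[of "(\<lambda>_. PI)(c := PZ, t := PX)"] acting_on_mult_pauli[of c t PZ PX]
      by (auto simp: mat_minus_imp intro!: neg)
  qed
  show ?thesis
    unfolding directions_def direction_expand
    using H X Y ZX
    by (auto intro!: subspace_add[OF subspace_su] subspace_sum[OF subspace_su] subspace_scale[OF subspace_su])
qed

lemma generators_directions:
  assumes H0: "self_adjoint H0" "trace H0 = 0" and E: "irrefl E" and M: "M > 0"
    and conn: "\<And>u v. (u, v) \<in> (E \<union> E\<inverse>)\<^sup>*"
  shows "generators (directions H0 E M)"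
proof
  have mem: "mat (- \<i>) ** const_hamiltonian H0 E x y w \<in> directions H0 E M"
    if "\<And>k. \<bar>x k\<bar> \<le> M" "\<And>k. \<bar>y k\<bar> \<le> M" "\<And>c t. \<bar>w c t\<bar> \<le> M" for x y w
    using that unfolding directions_def by blast
  show "directions H0 E M \<noteq> {}"
    using mem[of "\<lambda>_. 0" "\<lambda>_. 0" "\<lambda>_ _. 0"] M by auto
  show "directions H0 E M \<subseteq> su" using directions_subset_su[OF H0 E] .
  fix V :: "'a qubit_operator set"
  assume V: "subspace V" and sub: "directions H0 E M \<subseteq> V"
    and bracket: "\<And>A B. A \<in> V \<Longrightarrow> B \<in> V \<Longrightarrow> A ** B - B ** A \<in> V"
  let ?A = "\<lambda>x y w. mat (- \<i>) ** const_hamiltonian H0 E x y w"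
  let ?O = "\<lambda>_. 0 :: real" and ?OO = "\<lambda>_ _. 0 :: real"
  \<comment> \<open>Raising one control from 0 to M and subtracting cancels the drift and isolates
    one control operator; the factor \<open>- 1 / M\<close> removes scale and sign.\<close>
  have diff: "P \<in> V" if "?A x y w - ?A ?O ?O ?OO = M *\<^sub>R (mat (- \<i>) ** P')" "P = mat \<i> ** P'"
      "\<And>k. \<bar>x k\<bar> \<le> M" "\<And>k. \<bar>y k\<bar> \<le> M" "\<And>c t. \<bar>w c t\<bar> \<le> M" for x y w P P'
  proof -
    have "?A x y w \<in> V" "?A ?O ?O ?OO \<in> V"
      using sub mem[OF that(3-5)] mem[of ?O ?O ?OO] M by auto
    then have "M *\<^sub>R (mat (- \<i>) ** P') \<in> V"
      using subspace_diff[OF V] that(1) by metis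
    then have "(- 1 / M) *\<^sub>R (M *\<^sub>R (mat (- \<i>) ** P')) \<in> V"
      by (rule subspace_scale[OF V])
    then show ?thesis using M that(2) by (simp add: mat_minus_imp)
  qed
  have if_scale: "(if b then M else 0) *\<^sub>R A = (if b then M *\<^sub>R A else 0)" for b and A :: "'a qubit_operator"
    by simp
  interpret pauli_closed V E
  proof
    show "mat \<i> ** acting_on pauli_X k \<in> V" for k
    proof (rule diff[OF _ refl])
      show "?A (\<lambda>j. if j = k then M else 0) ?O ?OO - ?A ?O ?O ?OO = M *\<^sub>R (mat (- \<i>) ** acting_on pauli_X k)"
        unfolding direction_expand if_scale by (simp add: sum.delta)
    qed (use M in auto)
    show "mat \<i> ** acting_on pauli_Y k \<in> V" for k
    proof (rule diff[OF _ refl])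
      show "?A ?O (\<lambda>j. if j = k then M else 0) ?OO - ?A ?O ?O ?OO = M *\<^sub>R (mat (- \<i>) ** acting_on pauli_Y k)"
        unfolding direction_expand if_scale by (simp add: sum.delta)
    qed (use M in auto)
    show "mat \<i> ** (acting_on pauli_Z c ** acting_on pauli_X t) \<in> V" if "(c, t) \<in> E" for c t
    proof (rule diff[OF _ refl])
      have "(\<Sum>e\<in>E. (if fst e = c \<and> snd e = t then M else 0) *\<^sub>R
            (mat (- \<i>) ** (acting_on pauli_Z (fst e) ** acting_on pauli_X (snd e)))) =
          (\<Sum>e\<in>E. if e = (c, t) then M *\<^sub>R (mat (- \<i>) ** (acting_on pauli_Z c ** acting_on pauli_X t)) else 0)"
        by (intro sum.cong) (auto simp: prod_eq_iff)
      also have "\<dots> = M *\<^sub>R (mat (- \<i>) ** (acting_on pauli_Z c ** acting_on pauli_X t))"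
        using that by (simp add: sum.delta)
      finally show "?A ?O ?O (\<lambda>a b. if a = c \<and> b = t then M else 0) - ?A ?O ?O ?OO =
          M *\<^sub>R (mat (- \<i>) ** (acting_on pauli_Z c ** acting_on pauli_X t))"
        unfolding direction_expand by simp
    qed (use M in auto)
  qed (use V bracket E conn in auto)
  show "su \<subseteq> V" by (rule su_subset)
qed

text \<open>A form of solution that is stable under concatenation: Lipschitz trajectories,
  derivatives off a finite set of switching times, and Borel controls bounded on the whole
  line.\<close>

definition steers ::
  "'n::finite qubit_operator \<Rightarrow> ('n \<times> 'n) set \<Rightarrow> real \<Rightarrow> real \<Rightarrow> ('n \<Rightarrow> real \<Rightarrow> real) \<Rightarrow> ('n \<Rightarrow> real \<Rightarrow> real) \<Rightarrow>
    ('n \<Rightarrow> 'n \<Rightarrow> real \<Rightarrow> real) \<Rightarrow> (real \<Rightarrow> 'n qubit_operator) \<Rightarrow> bool" where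
  "steers H0 E M T uX uY v U \<longleftrightarrow>
     (\<forall>k. uX k \<in> borel_measurable borel \<and> (\<forall>t. \<bar>uX k t\<bar> \<le> M) \<and>
          uY k \<in> borel_measurable borel \<and> (\<forall>t. \<bar>uY k t\<bar> \<le> M)) \<and>
     (\<forall>c s. v c s \<in> borel_measurable borel \<and> (\<forall>t. \<bar>v c s t\<bar> \<le> M)) \<and>
     (\<exists>L. L-lipschitz_on {0..T} U) \<and> U 0 = mat 1 \<and>
     (\<exists>F. finite F \<and> (\<forall>t\<in>{0<..<T} - F.
        \<exists>D. (U has_vector_derivative D) (at t) \<and> mat \<i> ** D = hamiltonian H0 E uX uY v t ** U t))"

lemma mexp_mult_has_vector_derivative:
  "((\<lambda>t. mexp A (t - T) ** B) has_vector_derivative A ** (mexp A (t - T) ** B)) (at t within S)"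
proof -
  have "((\<lambda>t. mexp A (t - T)) has_vector_derivative A ** mexp A (t - T)) (at t within S)"
    using mexp_has_vector_derivative_affine[of A 1 "- T" t] by (simp add: has_vector_derivative_at_within)
  from bounded_linear.has_vector_derivative[OF mm.bounded_linear_left this, of B] show ?thesis
    by (simp only: matrix_mul_assoc)
qed

lemma mexp_mult_lipschitz: "\<exists>L. L-lipschitz_on {a..b} (\<lambda>t. mexp A (t - T) ** B)"
proof -
  have "compact ((\<lambda>t. A ** (mexp A (t - T) ** B)) ` {a..b})"
    by (intro compact_continuous_image mm.continuous_on continuous_intros) auto
  then have "bounded ((\<lambda>t. A ** (mexp A (t - T) ** B)) ` {a..b})"
    by (rule compact_imp_bounded)
  then obtain L where L: "L > 0" "\<And>t. t \<in> {a..b} \<Longrightarrow> norm (A ** (mexp A (t - T) ** B)) \<le> L"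
    unfolding bounded_pos by auto
  have "L-lipschitz_on {a..b} (\<lambda>t. mexp A (t - T) ** B)"
  proof (rule bounded_derivative_imp_lipschitz)
    show "((\<lambda>t. mexp A (t - T) ** B) has_derivative (\<lambda>h. h *\<^sub>R (A ** (mexp A (t - T) ** B)))) (at t within {a..b})" for t
      using mexp_mult_has_vector_derivative[of A T B t] by (simp add: has_vector_derivative_def)
    show "onorm (\<lambda>h. h *\<^sub>R (A ** (mexp A (t - T) ** B))) \<le> L" if "t \<in> {a..b}" for t
      using L(2)[OF that] L(1) by (intro onorm_bound) (auto intro: mult_left_mono simp: mult.commute[of L])
  qed (use L(1) in auto)
  then show ?thesis by blast
qed

lemma steers_append:
  assumes st: "steers H0 E M T uX uY v U" and T: "T \<ge> 0" and \<tau>: "\<tau> > 0"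
    and A: "A \<in> directions H0 E M"
  shows "\<exists>uX uY v U'. steers H0 E M (T + \<tau>) uX uY v U' \<and> U' (T + \<tau>) = mexp A \<tau> ** U T"
proof -
  obtain x y w where A: "A = mat (- \<i>) ** const_hamiltonian H0 E x y w"
    and bnd: "\<And>k. \<bar>x k\<bar> \<le> M" "\<And>k. \<bar>y k\<bar> \<le> M" "\<And>c t. \<bar>w c t\<bar> \<le> M"
    using A unfolding directions_def by blast
  obtain L F where L: "L-lipschitz_on {0..T} U" and F: "finite F"
    "\<And>t. t \<in> {0<..<T} - F \<Longrightarrow> \<exists>D. (U has_vector_derivative D) (at t) \<and> mat \<i> ** D = hamiltonian H0 E uX uY v t ** U t"
    using st unfolding steers_def by blast
  define uX' where "uX' k t = (if t \<le> T then uX k t else x k)" for k t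
  define uY' where "uY' k t = (if t \<le> T then uY k t else y k)" for k t
  define v' where "v' c s t = (if t \<le> T then v c s t else w c s)" for c s t
  let ?g = "\<lambda>t. mexp A (t - T) ** U T"
  \<comment> \<open>The two pieces agree at the switching time because the exponential starts at the
    identity.\<close>
  define U' where "U' t = (if t \<le> T then U t else ?g t)" for t
  have before: "hamiltonian H0 E uX' uY' v' t = hamiltonian H0 E uX uY v t" if "t \<le> T" for t
    using that by (simp add: hamiltonian_def uX'_def uY'_def v'_def)
  have after: "hamiltonian H0 E uX' uY' v' t = const_hamiltonian H0 E x y w" if "t > T" for t
    using that by (simp add: hamiltonian_def uX'_def uY'_def v'_def)
  have switch: "(\<lambda>t. if t \<le> T then u t else c) \<in> borel_measurable borel"
    if "u \<in> borel_measurable borel" for u :: "real \<Rightarrow> real" and c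
    using that by (intro measurable_If) auto
  obtain L' where "L'-lipschitz_on {T..T + \<tau>} ?g" using mexp_mult_lipschitz by blast
  then have "(max L L')-lipschitz_on {0..T + \<tau>} U'"
    unfolding U'_def using L by (intro lipschitz_on_concat_max) auto
  \<comment> \<open>The switching time joins the exceptional set: one-sided velocities may differ
    there.\<close>
  moreover have "\<exists>D. (U' has_vector_derivative D) (at t) \<and> mat \<i> ** D = hamiltonian H0 E uX' uY' v' t ** U' t"
    if t: "t \<in> {0<..<T + \<tau>} - insert T F" for t
  proof (cases "t < T")
    case True
    then obtain D where D: "(U has_vector_derivative D) (at t)" "mat \<i> ** D = hamiltonian H0 E uX uY v t ** U t"
      using F(2)[of t] t by auto
    have "(U' has_vector_derivative D) (at t)"
      by (rule has_vector_derivative_transform_within_open[OF D(1), of "{..<T}"]) (use True in \<open>auto simp: U'_def\<close>)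
    then show ?thesis using D(2) True before[of t] by (auto simp: U'_def)
  next
    case False
    then have tT: "t > T" using t by auto
    have "(U' has_vector_derivative A ** ?g t) (at t)"
      by (rule has_vector_derivative_transform_within_open[OF mexp_mult_has_vector_derivative, of "{T<..}"])
         (use tT in \<open>auto simp: U'_def\<close>)
    moreover have "mat \<i> ** (A ** ?g t) = hamiltonian H0 E uX' uY' v' t ** U' t"
    proof -
      have "mat \<i> ** (A ** ?g t) = (mat \<i> ** mat (- \<i>)) ** (const_hamiltonian H0 E x y w ** ?g t)"
        by (simp only: A matrix_mul_assoc)
      then show ?thesis using tT by (simp add: mat_mat after U'_def)
    qed
    ultimately show ?thesis by blast
  qed
  moreover have "finite (insert T F)" using F(1) by simp
  moreover have "U' 0 = mat 1" using st T by (simp add: U'_def steers_def)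
  moreover have "uX' k \<in> borel_measurable borel \<and> (\<forall>t. \<bar>uX' k t\<bar> \<le> M) \<and>
      uY' k \<in> borel_measurable borel \<and> (\<forall>t. \<bar>uY' k t\<bar> \<le> M)" for k
    using st bnd unfolding steers_def uX'_def[abs_def] uY'_def[abs_def] by (auto intro: switch)
  moreover have "v' c s \<in> borel_measurable borel \<and> (\<forall>t. \<bar>v' c s t\<bar> \<le> M)" for c s
    using st bnd unfolding steers_def v'_def[abs_def] by (auto intro: switch)
  ultimately have "steers H0 E M (T + \<tau>) uX' uY' v' U'"
    unfolding steers_def by blast
  moreover have "U' (T + \<tau>) = mexp A \<tau> ** U T" using \<tau> by (simp add: U'_def)
  ultimately show ?thesis by blast
qed

text \<open>The constant trajectory on an interval of length 0 is a legitimate starting point, so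
  the first pulse is an append like every other.\<close>

lemma reach_steers:
  assumes "s \<in> reach (directions H0 E M)" and M: "M \<ge> 0"
  shows "\<exists>T>0. \<exists>uX uY v U. steers H0 E M T uX uY v U \<and> U T = s"
  using assms(1)
proof (induction rule: reach.induct)
  case (mexp A t)
  have "steers H0 E M 0 (\<lambda>_ _. 0) (\<lambda>_ _. 0) (\<lambda>_ _ _. 0) (\<lambda>_. mat 1)"
    using M by (auto simp: steers_def intro: lipschitz_on_constant)
  from steers_append[OF this order_refl mexp(2,1)] show ?case
    using mexp(2) by (auto intro!: exI[of _ t])
next
  case (step A t s)
  then obtain T uX uY v U where "T > 0" "steers H0 E M T uX uY v U" "U T = s" by blast
  with steers_append[OF this(2) _ step(2,1)] show ?case
    using step(2) by (intro exI[of _ "T + t"]) auto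
qed

section \<open>Regularity of trajectories and controls\<close>

lemma lipschitz_imp_abs_continuous:
  fixes f :: "real \<Rightarrow> 'a::real_normed_vector"
  assumes L: "L-lipschitz_on S f" shows "abs_continuous_on S f"
  unfolding abs_continuous_on_def
proof (intro allI impI)
  fix \<epsilon> :: real assume \<epsilon>: "\<epsilon> > 0"
  have "L \<ge> 0" using L by (rule lipschitz_on_nonneg)
  \<comment> \<open>Dividing by \<open>L + 1\<close> instead of L also covers constant functions
    with L = 0.\<close>
  have "(\<Sum>K\<in>d. norm (f (Sup K) - f (Inf K))) < \<epsilon>"
    if d: "d division_of \<Union>d" "\<Union>d \<subseteq> S" "(\<Sum>K\<in>d. Sup K - Inf K) < \<epsilon> / (L + 1)" for d
  proof -
    have K: "norm (f (Sup K) - f (Inf K)) \<le> L * (Sup K - Inf K) \<and> 0 \<le> Sup K - Inf K" if Kd: "K \<in> d" for K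
    proof -
      obtain a b where "K = cbox a b" using division_ofD(4)[OF d(1) Kd] by blast
      then have ab: "K = {a..b}" "a \<le> b"
        using division_ofD(3)[OF d(1) Kd] by simp_all
      have "K \<subseteq> S" using d(2) Kd by blast
      then have "a \<in> S" "b \<in> S" using ab by auto
      then show ?thesis
        using lipschitz_onD[OF L, of b a] ab by (simp add: dist_norm)
    qed
    have "(\<Sum>K\<in>d. norm (f (Sup K) - f (Inf K))) \<le> L * (\<Sum>K\<in>d. Sup K - Inf K)"
      unfolding sum_distrib_left using K by (intro sum_mono) auto
    also have "\<dots> \<le> (L + 1) * (\<Sum>K\<in>d. Sup K - Inf K)"
      using K by (intro mult_right_mono sum_nonneg) auto
    also have "\<dots> < \<epsilon>"
      using d(3) \<open>L \<ge> 0\<close> by (simp add: pos_less_divide_eq mult.commute)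
    finally show ?thesis .
  qed
  moreover have "\<epsilon> / (L + 1) > 0" using \<epsilon> \<open>L \<ge> 0\<close> by simp
  ultimately show "\<exists>\<delta>>0. \<forall>d. d division_of \<Union>d \<and> \<Union>d \<subseteq> S \<and> (\<Sum>K\<in>d. Sup K - Inf K) < \<delta> \<longrightarrow>
      (\<Sum>K\<in>d. norm (f (Sup K) - f (Inf K))) < \<epsilon>"
    by (intro exI[of _ "\<epsilon> / (L + 1)"]) simp
qed

lemma steers_schroedinger_solution:
  assumes "steers H0 E M T uX uY v U"
  shows "schroedinger_solution (hamiltonian H0 E uX uY v) T U"
proof -
  obtain L F where L: "L-lipschitz_on {0..T} U" and F: "finite F"
    "\<And>t. t \<in> {0<..<T} - F \<Longrightarrow> \<exists>D. (U has_vector_derivative D) (at t) \<and> mat \<i> ** D = hamiltonian H0 E uX uY v t ** U t"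
    using assms unfolding steers_def by blast
  have "F \<in> null_sets lebesgue"
    using F(1) negligible_finite negligible_iff_null_sets by blast
  then have "AE t in lebesgue. t \<notin> F" by (rule AE_not_in)
  then have "AE t in lebesgue. t \<in> {0<..<T} \<longrightarrow>
      (\<exists>D. (U has_vector_derivative D) (at t) \<and> mat \<i> ** D = hamiltonian H0 E uX uY v t ** U t)"
    by (rule eventually_mono) (use F(2) in blast)
  then show ?thesis
    using assms lipschitz_imp_abs_continuous[OF L] by (simp add: schroedinger_solution_def steers_def)
qed

lemma admissible_controlI:
  assumes "u \<in> borel_measurable borel" "\<And>t. \<bar>u t\<bar> \<le> M"
  shows "admissible_control M T u"
proof -
  have "u \<in> borel_measurable lborel" using assms(1) by simp
  then have "u \<in> borel_measurable lebesgue" by (rule measurable_completion)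
  then have "u \<in> borel_measurable (lebesgue_on {0..T})" by (rule measurable_restrict_space1)
  then show ?thesis
    using assms(2) unfolding admissible_control_def by (auto simp: abs_le_iff minus_le_iff)
qed

theorem operator_controllable:
  fixes H0 :: "'n::finite qubit_operator"
  assumes M: "M > 0" and H0: "self_adjoint H0" "trace H0 = 0" and E: "irrefl E"
    and conn: "Digraph_Component.connected (with_proj \<lparr>pverts = UNIV, parcs = E\<rparr>)"
    and \<Gamma>: "special_unitary \<Gamma>"
  shows "\<exists>T>0. \<exists>uX uY v.
       (\<forall>k. admissible_control M T (uX k) \<and> admissible_control M T (uY k)) \<and>
       (\<forall>(c, t')\<in>E. admissible_control M T (v c t')) \<and>
       (\<exists>U. schroedinger_solution (hamiltonian H0 E uX uY v) T U \<and> U T = \<Gamma>)"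
proof -
  \<comment> \<open>Connectedness of the digraph is strong connectedness after adding all reversed
    arcs, which turns into reachability by \<open>E \<union> E\<inverse>\<close>.\<close>
  have "(\<lambda>(a, b). (b, a)) ` E = E\<inverse>" by auto
  then have "(u, v) \<in> (E \<union> E\<inverse>)\<^sup>*" for u v
    using conn rtrancl_on_rtranclI[of u v UNIV "E \<union> E\<inverse>"]
    by (simp add: connected_conv arcs_ends_conv symcl_def)
  then interpret generators "directions H0 E M"
    by (intro generators_directions H0 E M)
  obtain T uX uY v U where T: "T > 0" and st: "steers H0 E M T uX uY v U" and U: "U T = \<Gamma>"
    using reach_steers[OF special_unitary_subset_reach[OF \<Gamma>]] M by fastforce
  have "admissible_control M T (uX k) \<and> admissible_control M T (uY k)" for k
    using st by (auto simp: steers_def intro!: admissible_controlI)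
  moreover have "admissible_control M T (v c s)" for c s
    using st by (auto simp: steers_def intro!: admissible_controlI)
  moreover have "schroedinger_solution (hamiltonian H0 E uX uY v) T U"
    using st by (rule steers_schroedinger_solution)
  ultimately show ?thesis using T U by (intro exI[of _ T] conjI exI[of _ uX] exI[of _ uY] exI[of _ v] exI[of _ U]) auto
qed

theorem proposition1:
  fixes M :: real
    and H0 :: "127 qubit_operator"
    and E :: "(127 \<times> 127) set"
  assumes "M > 0"
    and "self_adjoint H0" and "trace H0 = 0"
    and "irrefl E"
    and "Digraph_Component.connected (with_proj \<lparr>pverts = UNIV, parcs = E\<rparr>)"
  shows "\<forall>\<Gamma> :: 127 qubit_operator. special_unitary \<Gamma> \<longrightarrow>
    (\<exists>T>0. \<exists>uX uY v.
       (\<forall>k. admissible_control M T (uX k) \<and> admissible_control M T (uY k)) \<and>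
       (\<forall>(c, t')\<in>E. admissible_control M T (v c t')) \<and>
       (\<exists>U. schroedinger_solution (hamiltonian H0 E uX uY v) T U \<and> U T = \<Gamma>))"
  using operator_controllable[OF assms] by blast

end
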